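(* Let $m\in\mathbb{N}$ and $1\le p\le\infty$, let $A_0,A_1$ be complex $m\times m$ matrices with $A_1\neq 0$, and suppose that there is a rational function $\phi$ (the characteristic function) such that $A_1R(\lambda,A_0)A_1=\phi(\lambda)A_1$ for all $\lambda\in\rho(A_0)$. Let $A$ be the bounded operator on $X=\ell^p(\mathbb{N},\mathbb{C}^m)$ given by $Ax=(A_0x_1,\,A_0x_2+A_1x_1,\,A_0x_3+A_1x_2,\dots)$ for $x=(x_k)_{k\ge1}\in X$, and let $(T(t))_{t\ge0}$ be the $C_0$-semigroup generated by $A$. Suppose that $\sigma(A_0)\subseteq\mathbb{C}_-$, that $\Omega_\phi^+\subseteq\overline{\mathbb{C}_-}$, where $\Omega_\phi^+=\{\lambda\in\rho(A_0):|\phi(\lambda)|\ge1\}$, and that $\phi$ is completely monotonic. Then $(T(t))_{t\ge0}$ is bounded, that is, $\sup_{t\ge0}\|T(t)\|<\infty$.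
   Context: $\mathbb{C}_-=\{\lambda\in\mathbb{C}:\operatorname{Re}\lambda<0\}$ and $\overline{\mathbb{C}_-}$ is its closure. $\sigma$ and $\rho$ denote spectrum and resolvent set, and $R(\lambda,A_0)=(\lambda-A_0)^{-1}$. The space $\ell^p(\mathbb{N},\mathbb{C}^m)$ carries its natural norm, with the Euclidean norm on $\mathbb{C}^m$. A smooth function $f\colon(0,\infty)\to\mathbb{R}$ is completely monotonic if $(-1)^nf^{(n)}(s)\ge0$ for all $s>0$ and all integers $n\ge0$. The characteristic function $\phi$ is said to be completely monotonic if $(0,\infty)\subseteq\rho(A_0)$ and the restriction of $\phi$ to $(0,\infty)$ is real-valued and completely monotonic. *)

theory Defs
  imports "HOL-Analysis.Analysis" "HOL-Computational_Algebra.Polynomial"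
begin

definition matrix_resolvent_set :: "complex^'m^'m \<Rightarrow> complex set" where
  "matrix_resolvent_set A = {z. invertible (mat z - A)}"

definition matrix_spectrum :: "complex^'m^'m \<Rightarrow> complex set" where
  "matrix_spectrum A = - matrix_resolvent_set A"

definition matrix_resolvent :: "complex \<Rightarrow> complex^'m^'m \<Rightarrow> complex^'m^'m" where
  "matrix_resolvent z A = matrix_inv (mat z - A)"

definition matrix_scale :: "complex \<Rightarrow> complex^'m^'m \<Rightarrow> complex^'m^'m" where
  "matrix_scale c A = (\<chi> i j. c * A $ i $ j)"

text \<open>The representing fraction is in lowest terms, so the convention \<open>x / 0 = 0\<close> only
  affects the values at genuine poles.\<close>

definition rational_function :: "(complex \<Rightarrow> complex) \<Rightarrow> bool" where
  "rational_function f \<longleftrightarrow>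
     (\<exists>P Q. Q \<noteq> 0 \<and> coprime P Q \<and> (\<forall>z. f z = poly P z / poly Q z))"

text \<open>If \<open>A1 \<noteq> 0\<close>, the equation below determines \<open>\<phi>\<close> on the resolvent set of \<open>A0\<close>,
  and it implies that \<open>\<phi>\<close> has no pole there.\<close>

definition characteristic_function ::
    "complex^'m^'m \<Rightarrow> complex^'m^'m \<Rightarrow> (complex \<Rightarrow> complex) \<Rightarrow> bool" where
  "characteristic_function A0 A1 \<phi> \<longleftrightarrow>
     rational_function \<phi> \<and>
     (\<forall>z\<in>matrix_resolvent_set A0.
        A1 ** matrix_resolvent z A0 ** A1 = matrix_scale (\<phi> z) A1)"

definition Omega_plus :: "complex^'m^'m \<Rightarrow> (complex \<Rightarrow> complex) \<Rightarrow> complex set" where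
  "Omega_plus A0 \<phi> = {z \<in> matrix_resolvent_set A0. cmod (\<phi> z) \<ge> 1}"

definition completely_monotonic :: "(real \<Rightarrow> real) \<Rightarrow> bool" where
  "completely_monotonic f \<longleftrightarrow>
     (\<forall>n. \<forall>s>0. (deriv ^^ n) f differentiable (at s) \<and> (- 1) ^ n * (deriv ^^ n) f s \<ge> 0)"

definition char_fun_completely_monotonic ::
    "complex^'m^'m \<Rightarrow> (complex \<Rightarrow> complex) \<Rightarrow> bool" where
  "char_fun_completely_monotonic A0 \<phi> \<longleftrightarrow>
     complex_of_real ` {0<..} \<subseteq> matrix_resolvent_set A0 \<and>
     (\<forall>s>0. \<phi> (complex_of_real s) \<in> \<real>) \<and>
     completely_monotonic (\<lambda>s. Re (\<phi> (complex_of_real s)))"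

text \<open>Sequences are indexed from \<open>0\<close>: the entry \<open>x (k - 1)\<close> is the entry $x_k$ of a sequence
  $(x_k)_{k \ge 1}$. The type \<open>complex^'m\<close> carries the Euclidean norm.\<close>

definition lp_space :: "ennreal \<Rightarrow> (nat \<Rightarrow> complex^'m) set" where
  "lp_space p =
     {x. if p = \<infinity> then bounded (range x) else summable (\<lambda>k. norm (x k) powr enn2real p)}"

definition lp_norm :: "ennreal \<Rightarrow> (nat \<Rightarrow> complex^'m) \<Rightarrow> real" where
  "lp_norm p x =
     (if p = \<infinity> then (SUP k. norm (x k))
      else (\<Sum>k. norm (x k) powr enn2real p) powr (1 / enn2real p))"

text \<open>Operators on \<open>lp_space p\<close> are total functions on sequences whose values outside
  \<open>lp_space p\<close> are irrelevant.\<close>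

definition lp_bounded_operator ::
    "ennreal \<Rightarrow> ((nat \<Rightarrow> complex^'m) \<Rightarrow> (nat \<Rightarrow> complex^'m)) \<Rightarrow> bool" where
  "lp_bounded_operator p S \<longleftrightarrow>
     (\<forall>x\<in>lp_space p. S x \<in> lp_space p) \<and>
     (\<forall>x\<in>lp_space p. \<forall>y\<in>lp_space p. S (\<lambda>k. x k + y k) = (\<lambda>k. S x k + S y k)) \<and>
     (\<forall>c. \<forall>x\<in>lp_space p. S (\<lambda>k. c *s x k) = (\<lambda>k. c *s S x k)) \<and>
     (\<exists>C. \<forall>x\<in>lp_space p. lp_norm p (S x) \<le> C * lp_norm p x)"

text \<open>Only meaningful for \<open>lp_bounded_operator p S\<close>, since \<open>Sup\<close> on the reals is arbitrary on
  unbounded sets.\<close>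

definition lp_operator_norm ::
    "ennreal \<Rightarrow> ((nat \<Rightarrow> complex^'m) \<Rightarrow> (nat \<Rightarrow> complex^'m)) \<Rightarrow> real" where
  "lp_operator_norm p S = Sup {lp_norm p (S x) | x. x \<in> lp_space p \<and> lp_norm p x \<le> 1}"

definition block_operator ::
    "complex^'m^'m \<Rightarrow> complex^'m^'m \<Rightarrow> (nat \<Rightarrow> complex^'m) \<Rightarrow> (nat \<Rightarrow> complex^'m)" where
  "block_operator A0 A1 x =
     (\<lambda>k. case k of 0 \<Rightarrow> A0 *v x 0 | Suc j \<Rightarrow> A0 *v x (Suc j) + A1 *v x j)"

definition lp_C0_semigroup ::
    "ennreal \<Rightarrow> (real \<Rightarrow> (nat \<Rightarrow> complex^'m) \<Rightarrow> (nat \<Rightarrow> complex^'m)) \<Rightarrow> bool" where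
  "lp_C0_semigroup p T \<longleftrightarrow>
     (\<forall>t\<ge>0. lp_bounded_operator p (T t)) \<and>
     (\<forall>x\<in>lp_space p. T 0 x = x) \<and>
     (\<forall>s\<ge>0. \<forall>t\<ge>0. \<forall>x\<in>lp_space p. T (s + t) x = T s (T t x)) \<and>
     (\<forall>x\<in>lp_space p. ((\<lambda>t. lp_norm p (\<lambda>k. T t x k - x k)) \<longlongrightarrow> 0) (at_right 0))"

text \<open>The generator is represented by its graph, so that its domain is part of the data.\<close>

definition lp_generator ::
    "ennreal \<Rightarrow> (real \<Rightarrow> (nat \<Rightarrow> complex^'m) \<Rightarrow> (nat \<Rightarrow> complex^'m)) \<Rightarrow>
       ((nat \<Rightarrow> complex^'m) \<times> (nat \<Rightarrow> complex^'m)) set" where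
  "lp_generator p T =
     {(x, y). x \<in> lp_space p \<and> y \<in> lp_space p \<and>
        ((\<lambda>t. lp_norm p (\<lambda>k. (T t x k - x k) /\<^sub>R t - y k)) \<longlongrightarrow> 0) (at_right 0)}"

definition lp_semigroup_generated_by ::
    "ennreal \<Rightarrow> ((nat \<Rightarrow> complex^'m) \<Rightarrow> (nat \<Rightarrow> complex^'m)) \<Rightarrow>
       (real \<Rightarrow> (nat \<Rightarrow> complex^'m) \<Rightarrow> (nat \<Rightarrow> complex^'m)) \<Rightarrow> bool" where
  "lp_semigroup_generated_by p A T \<longleftrightarrow>
     lp_C0_semigroup p T \<and> lp_generator p T = {(x, A x) | x. x \<in> lp_space p}"

end

theory Submission
  imports Defs "HOL-Computational_Algebra.Fundamental_Theorem_Algebra"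
begin

text \<open>Write \<open>E(t) = exp(t A\<^sub>0)\<close>. The components \<open>y\<^sub>k\<close> of an orbit of the semigroup form the cascade
\<open>y\<^sub>0' = A\<^sub>0 y\<^sub>0\<close>, \<open>y\<^sub>k' = A\<^sub>0 y\<^sub>k + A\<^sub>1 y\<^sub>k\<^sub>-\<^sub>1\<close>. In the time domain the characteristic equation says that
\<open>A\<^sub>1 E(t) A\<^sub>1 = h(t) A\<^sub>1\<close> for a scalar function \<open>h\<close> whose Laplace transform is \<open>\<phi>\<close>. So \<open>z\<^sub>k = A\<^sub>1 y\<^sub>k\<close>
solves a scalar Volterra cascade
\[ z_k(t) = A_1 E(t)\, y_k(0) + \int_0^t h(t-s)\, z_{k-1}(s)\, ds , \]
and with \<open>\<parallel>E(t)\<parallel> \<le> M exp(-b t)\<close> the influence of the initial entry \<open>y\<^sub>j(0)\<close> on \<open>z\<^sub>k(t)\<close> is at most a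
constant times \<open>g\<^sub>k\<^sub>-\<^sub>j(t)\<close>, where \<open>g\<^sub>0(t) = exp(-b t)\<close> and \<open>g\<^sub>n\<^sub>+\<^sub>1 = h * g\<^sub>n\<close>, provided that \<open>h \<ge> 0\<close>. By
Young's inequality for sequences it is enough to bound \<open>\<Sum>\<^sub>n g\<^sub>n(t)\<close> uniformly in \<open>t\<close>; this treats all
exponents \<open>p\<close> at once.

Complete monotonicity gives \<open>h \<ge> 0\<close>. Differentiating the characteristic equation shows that
\<open>A\<^sub>1 R(s)\<^sup>k A\<^sub>1\<close> is a nonnegative multiple of \<open>A\<^sub>1\<close> for all \<open>s > 0\<close> and \<open>k \<ge> 1\<close>, and \<open>E(t)\<close> is a limit of
nonnegative combinations of powers of resolvents by the Yosida approximation. The hypothesis on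
\<open>\<Omega>\<^sub>\<phi>\<^sup>+\<close> forces \<open>\<phi>(s) < 1\<close> for \<open>s > 0\<close>, and letting \<open>s\<close> tend to \<open>0\<close> yields \<open>\<integral> h \<le> 1\<close>.

The sum \<open>\<Sum>\<^sub>n g\<^sub>n\<close> is then bounded even in the critical case \<open>\<integral> h = 1\<close>, by a renewal argument: the
minimal solution of \<open>v = exp(-b t) + h * v\<close> lies below every nonnegative supersolution, and a bounded
supersolution can be written down explicitly (lemma \<open>renewal_sum_bounded\<close>).

Two further ingredients are classical. The exponential decay of \<open>E(t)\<close> is obtained from an
annihilating polynomial of each vector, split into linear factors. That the components of an
abstract semigroup satisfy the cascade requires local boundedness of the semigroup, hence a uniform
boundedness principle on the sequence space, proved by a gliding hump.\<close>

section \<open>The Banach algebra of bounded endomorphisms\<close>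

text \<open>A type copy of the bounded linear maps of a space into itself, so that composition can be the product
of the class \<^class>\<open>real_normed_algebra_1\<close> and the exponential series is available.\<close>
typedef (overloaded) ('a::real_normed_vector) endo = "UNIV :: ('a \<Rightarrow>\<^sub>L 'a) set"
  by simp

setup_lifting type_definition_endo

instantiation endo :: (real_normed_vector) real_normed_vector
begin
lift_definition zero_endo :: "'a endo" is 0 .
lift_definition plus_endo :: "'a endo \<Rightarrow> 'a endo \<Rightarrow> 'a endo" is "(+)" .
lift_definition minus_endo :: "'a endo \<Rightarrow> 'a endo \<Rightarrow> 'a endo" is "(-)" .
lift_definition uminus_endo :: "'a endo \<Rightarrow> 'a endo" is uminus .
lift_definition scaleR_endo :: "real \<Rightarrow> 'a endo \<Rightarrow> 'a endo" is scaleR .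
lift_definition norm_endo :: "'a endo \<Rightarrow> real" is norm .
lift_definition dist_endo :: "'a endo \<Rightarrow> 'a endo \<Rightarrow> real" is dist .
lift_definition sgn_endo :: "'a endo \<Rightarrow> 'a endo" is sgn .

definition uniformity_endo :: "('a endo \<times> 'a endo) filter"
  where "uniformity_endo = (INF e\<in>{0 <..}. principal {(x, y). dist x y < e})"

definition open_endo :: "'a endo set \<Rightarrow> bool"
  where "open_endo U \<longleftrightarrow> (\<forall>x\<in>U. eventually (\<lambda>(x', y). x' = x \<longrightarrow> y \<in> U) uniformity)"

instance
proof
  show "dist x y = norm (x - y)" for x y :: "'a endo"
    by transfer (rule dist_norm)
  show "sgn x = inverse (norm x) *\<^sub>R x" for x :: "'a endo"
    by transfer (rule sgn_div_norm)
  show "norm (x + y) \<le> norm x + norm y" for x y :: "'a endo"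
    by transfer (rule norm_triangle_ineq)
qed (rule uniformity_endo_def open_endo_def | (transfer, simp add: algebra_simps))+
end

instance endo :: (banach) banach
proof
  fix X :: "nat \<Rightarrow> 'a endo"
  assume "Cauchy X"
  then have "Cauchy (\<lambda>n. Rep_endo (X n))"
    by (simp add: Cauchy_def dist_endo.rep_eq)
  then obtain L where "(\<lambda>n. Rep_endo (X n)) \<longlonglongrightarrow> L"
    using convergent_eq_Cauchy by blast
  then have "X \<longlonglongrightarrow> Abs_endo L"
    by (simp add: lim_sequentially dist_endo.rep_eq Abs_endo_inverse)
  then show "convergent X"
    by (auto simp: convergent_def)
qed

instantiation endo :: ("{real_normed_vector, perfect_space}") real_normed_algebra_1
begin
lift_definition one_endo :: "'a endo" is id_blinfun .
lift_definition times_endo :: "'a endo \<Rightarrow> 'a endo \<Rightarrow> 'a endo" is "(o\<^sub>L)" .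

instance
proof
  show "(0::'a endo) \<noteq> 1"
    by transfer (metis norm_blinfun_id norm_zero zero_neq_one)
  show "norm (1::'a endo) = 1"
    by transfer (rule norm_blinfun_id)
  show "norm (x * y) \<le> norm x * norm y" for x y :: "'a endo"
    by transfer (rule norm_blinfun_compose)
qed (transfer, auto intro!: blinfun_eqI simp: blinfun.bilinear_simps)+
end

lift_definition app :: "'a::real_normed_vector endo \<Rightarrow> 'a \<Rightarrow> 'a" is blinfun_apply .

lemma bounded_bilinear_app: "bounded_bilinear app"
proof
  show "\<exists>K. \<forall>a b. norm (app a b :: 'a) \<le> norm a * norm b * K"
    by (rule exI[of _ 1], transfer) (simp add: norm_blinfun)
qed (transfer, simp add: blinfun.bilinear_simps)+

interpretation app: bounded_bilinear app
  by (rule bounded_bilinear_app)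

lemma app_mult: "app (X * Y) v = app X (app Y v)"
  by transfer simp

lemma app_one: "app 1 v = v"
  by transfer simp

lemma norm_app: "norm (app X v) \<le> norm X * norm v"
  by transfer (rule norm_blinfun)

lemma endo_eqI: "(\<And>v. app X v = app Y v) \<Longrightarrow> X = Y"
  by transfer (rule blinfun_eqI)

text \<open>Lets pointwise decay of operators on finitely many vectors be upgraded to decay in operator norm.\<close>
lemma norm_endo_le_sum_Basis:
  fixes X :: "'a::euclidean_space endo"
  shows "norm X \<le> (\<Sum>b\<in>Basis. norm (app X b))"
proof transfer
  fix X :: "'a \<Rightarrow>\<^sub>L 'a"
  show "norm X \<le> (\<Sum>b\<in>Basis. norm (blinfun_apply X b))"
  proof (rule norm_blinfun_bound)
    show "norm (blinfun_apply X v) \<le> (\<Sum>b\<in>Basis. norm (blinfun_apply X b)) * norm v" for v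
    proof -
      have "blinfun_apply X v = (\<Sum>b\<in>Basis. (v \<bullet> b) *\<^sub>R blinfun_apply X b)"
        by (subst euclidean_representation[of v, symmetric])
           (simp only: blinfun.sum_right blinfun.scaleR_right)
      also have "norm \<dots> \<le> (\<Sum>b\<in>Basis. norm (blinfun_apply X b) * norm v)"
        by (intro sum_norm_le) (auto simp: mult.commute intro!: mult_right_mono Basis_le_norm)
      finally show ?thesis by (simp add: sum_distrib_right)
    qed
  qed (simp add: sum_nonneg)
qed

definition endo_of_matrix :: "complex^'m^'m \<Rightarrow> (complex^'m) endo" where
  "endo_of_matrix M = Abs_endo (Blinfun ((*v) M))"

lemma app_endo_of_matrix [simp]: "app (endo_of_matrix M) v = M *v v"
proof -
  have "linear ((*v) M)"
    by (rule linearI) (auto simp: vec_eq_iff matrix_vector_mult_def algebra_simps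
        sum.distrib scaleR_sum_right)
  then have "bounded_linear ((*v) M)"
    by (simp add: linear_conv_bounded_linear)
  then show ?thesis
    by (simp add: endo_of_matrix_def app.rep_eq Abs_endo_inverse bounded_linear_Blinfun_apply)
qed

lemma endo_of_matrix_mult: "endo_of_matrix (M ** N) = endo_of_matrix M * endo_of_matrix N"
  by (rule endo_eqI) (simp add: app_mult matrix_vector_mul_assoc)

lemma endo_of_matrix_diff: "endo_of_matrix (M - N) = endo_of_matrix M - endo_of_matrix N"
  by (rule endo_eqI) (simp add: app.diff_left matrix_vector_mult_diff_rdistrib)

lemma endo_of_matrix_mat:
  "endo_of_matrix (mat (of_real s) :: complex^'m^'m) = of_real s"
proof (rule endo_eqI)
  fix v :: "complex^'m"
  have "((mat (of_real s) :: complex^'m^'m) *v v) $ i = of_real s * v $ i" for i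
    unfolding matrix_vector_mult_def mat_def
    by (simp add: if_distrib[of "\<lambda>x. x * y" for y] cong: if_cong)
  then show "app (endo_of_matrix (mat (of_real s) :: complex^'m^'m)) v = app (of_real s) v"
    unfolding of_real_def[where 'a = "(complex^'m) endo"] app.scaleR_left app_one
    by (simp add: vec_eq_iff scaleR_conv_of_real[where 'a = complex])
qed

lemma endo_of_matrix_scale:
  fixes M :: "complex^'m^'m"
  shows "endo_of_matrix (matrix_scale (of_real c) M) = c *\<^sub>R endo_of_matrix M"
proof (rule endo_eqI)
  fix v :: "complex^'m"
  have "(matrix_scale (of_real c) M *v v) $ i = of_real c * (M *v v) $ i" for i
    unfolding matrix_vector_mult_def matrix_scale_def
    by (simp add: sum_distrib_left mult.assoc)
  then show "app (endo_of_matrix (matrix_scale (of_real c) M)) v = app (c *\<^sub>R endo_of_matrix M) v"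
    unfolding app.scaleR_left by (simp add: vec_eq_iff scaleR_conv_of_real[where 'a = complex])
qed

lemma endo_of_matrix_eq_0: "endo_of_matrix M = 0 \<Longrightarrow> M = 0"
  by (metis app_endo_of_matrix app.zero_left matrix_eq matrix_vector_mult_0)

section \<open>Resolvents on the positive half-line and the Yosida approximation\<close>

lemma norm_exp_minus_one_le:
  fixes x :: "'a::{real_normed_algebra_1, banach}"
  shows "norm (exp x - 1) \<le> exp (norm x) - 1"
proof -
  have le: "norm (x ^ (n + 1) /\<^sub>R fact (n + 1)) \<le> norm x ^ (n + 1) /\<^sub>R fact (n + 1)" for n
    using norm_power_ineq[of x "n + 1"] by (simp add: divide_inverse mult_left_mono)
  have sm: "summable (\<lambda>n. norm x ^ (n + 1) /\<^sub>R fact (n + 1))"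
    by (intro summable_ignore_initial_segment summable_exp_generic)
  have "norm (exp x - 1) = norm (\<Sum>n. x ^ (n + 1) /\<^sub>R fact (n + 1))"
    by (subst exp_first_term) simp
  also have "\<dots> \<le> (\<Sum>n. norm x ^ (n + 1) /\<^sub>R fact (n + 1))"
    by (rule norm_suminf_le[OF le sm])
  also have "\<dots> = exp (norm x) - 1"
    by (subst exp_first_term) simp
  finally show ?thesis .
qed

text \<open>Continuity of the exponential at \<open>0\<close> along an arbitrary filter, in a possibly noncommutative algebra.\<close>
lemma tendsto_exp_zero:
  fixes f :: "'b \<Rightarrow> 'a::{real_normed_algebra_1, banach}"
  assumes "(f \<longlongrightarrow> 0) F"
  shows "((\<lambda>x. exp (f x)) \<longlongrightarrow> 1) F"
proof -
  have "((\<lambda>x. exp (norm (f x)) - 1) \<longlongrightarrow> exp (norm (0::'a)) - 1) F"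
    by (intro tendsto_intros assms)
  then have "((\<lambda>x. exp (norm (f x)) - 1) \<longlongrightarrow> 0) F"
    by simp
  then have "((\<lambda>x. exp (f x) - 1) \<longlongrightarrow> 0) F"
    by (rule Lim_null_comparison[rotated]) (simp add: norm_exp_minus_one_le)
  then show ?thesis
    by (simp add: LIM_zero_iff)
qed

lemma has_vector_derivativeI_quotient:
  assumes "((\<lambda>u. (f u - f s) /\<^sub>R (u - s)) \<longlongrightarrow> D) (at s within S)"
  shows "(f has_vector_derivative D) (at s within S)"
proof -
  have "((\<lambda>u. norm ((f u - f s) /\<^sub>R (u - s) - D)) \<longlongrightarrow> 0) (at s within S)"
    using assms by (simp add: LIM_zero_iff tendsto_norm_zero_iff)
  then have "((\<lambda>u. (1 / norm (u - s)) *\<^sub>R (f u - (f s + (u - s) *\<^sub>R D))) \<longlongrightarrow> 0) (at s within S)"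
  proof (rule Lim_null_comparison[rotated])
    show "\<forall>\<^sub>F u in at s within S. norm ((1 / norm (u - s)) *\<^sub>R (f u - (f s + (u - s) *\<^sub>R D)))
        \<le> norm ((f u - f s) /\<^sub>R (u - s) - D)"
      using eventually_neq_at_within[of s s S]
    proof eventually_elim
      case (elim u)
      then have "D = ((u - s) *\<^sub>R D) /\<^sub>R (u - s)"
        by simp
      then have "(f u - f s) /\<^sub>R (u - s) - D = (f u - (f s + (u - s) *\<^sub>R D)) /\<^sub>R (u - s)"
        by (metis diff_diff_eq scaleR_diff_right)
      then show ?case
        by (simp add: divide_inverse abs_inverse)
    qed
  qed
  then show ?thesis
    by (simp add: has_vector_derivative_def has_derivative_within bounded_linear_scaleR_left)
qed

text \<open>\<open>R s\<close> is the resolvent of \<open>A\<close> at \<open>s\<close>; every \<open>s > 0\<close> is assumed to be a regular point.\<close>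
locale positive_resolvent =
  fixes A :: "'a::{real_normed_algebra_1, banach}" and R :: "real \<Rightarrow> 'a"
  assumes right_inverse: "s > 0 \<Longrightarrow> (of_real s - A) * R s = 1"
    and left_inverse: "s > 0 \<Longrightarrow> R s * (of_real s - A) = 1"
begin

lemma scaleR_R: "s > 0 \<Longrightarrow> s *\<^sub>R R s = 1 + A * R s"
  using right_inverse[of s] by (simp add: algebra_simps scaleR_conv_of_real)

lemma R_commute: "s > 0 \<Longrightarrow> R s * A = A * R s"
  using left_inverse[of s] scaleR_R[of s] by (simp add: right_diff_distrib of_real_def)

lemma R_tendsto_zero: "(R \<longlongrightarrow> 0) at_top"
proof (rule Lim_null_comparison)
  show "\<forall>\<^sub>F s in at_top. norm (R s) \<le> 1 / (s - norm A)"
    using eventually_gt_at_top[of "norm A"] eventually_gt_at_top[of 0]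
  proof eventually_elim
    case (elim s)
    have "s * norm (R s) = norm (1 + A * R s)"
      using elim by (simp flip: scaleR_R)
    also have "\<dots> \<le> 1 + norm A * norm (R s)"
      by (metis add_left_mono norm_mult_ineq norm_one norm_triangle_ineq order_trans)
    finally have "(s - norm A) * norm (R s) \<le> 1"
      by (simp add: algebra_simps)
    then show ?case
      using elim by (simp add: field_simps)
  qed
  show "((\<lambda>s. 1 / (s - norm A)) \<longlongrightarrow> 0) at_top"
    by real_asymp
qed

lemma scaleR_R_tendsto_one: "((\<lambda>s. s *\<^sub>R R s) \<longlongrightarrow> 1) at_top"
proof -
  have "((\<lambda>s. 1 + A * R s) \<longlongrightarrow> 1 + A * 0) at_top"
    by (intro tendsto_intros R_tendsto_zero)
  then have "((\<lambda>s. 1 + A * R s) \<longlongrightarrow> 1) at_top"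
    by simp
  then show ?thesis
    by (rule Lim_transform_eventually)
      (use eventually_gt_at_top[of 0] in eventually_elim, simp add: scaleR_R)
qed

text \<open>The Yosida approximations \<open>s\<^sup>2 R(s) - s = A + A\<^sup>2 R(s)\<close> tend to \<open>A\<close> and commute with it. Their exponential
is a positive multiple of \<open>exp(t s\<^sup>2 R(s))\<close>, a power series in the resolvent with nonnegative
coefficients, which is what transfers positivity from resolvents to the exponential.\<close>
lemma exp_eq_limit_Yosida:
  "((\<lambda>s. exp (- (s * t)) *\<^sub>R exp ((t * s\<^sup>2) *\<^sub>R R s)) \<longlongrightarrow> exp (t *\<^sub>R A)) at_top"
proof -
  have "((\<lambda>s. exp (t *\<^sub>R A) * exp (t *\<^sub>R (A * A * R s))) \<longlongrightarrow> exp (t *\<^sub>R A) * 1) at_top"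
  proof (intro tendsto_intros tendsto_exp_zero)
    have "((\<lambda>s. t *\<^sub>R (A * A * R s)) \<longlongrightarrow> t *\<^sub>R (A * A * 0)) at_top"
      by (intro tendsto_intros R_tendsto_zero)
    then show "((\<lambda>s. t *\<^sub>R (A * A * R s)) \<longlongrightarrow> 0) at_top"
      by simp
  qed
  then have "((\<lambda>s. exp (t *\<^sub>R A) * exp (t *\<^sub>R (A * A * R s))) \<longlongrightarrow> exp (t *\<^sub>R A)) at_top"
    by simp
  then show ?thesis
  proof (rule Lim_transform_eventually, use eventually_gt_at_top[of 0] in eventually_elim)
    case (elim s)
    have comm: "A * (A * A * R s) = (A * A * R s) * A"
      using R_commute[OF elim] by (simp add: mult.assoc)
    have "s\<^sup>2 *\<^sub>R R s = of_real s + A + A * A * R s"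
    proof -
      have "s\<^sup>2 *\<^sub>R R s = s *\<^sub>R (1 + A * R s)"
        by (simp add: power2_eq_square elim flip: scaleR_R)
      also have "\<dots> = of_real s + A * (s *\<^sub>R R s)"
        by (simp add: algebra_simps of_real_def)
      finally show ?thesis
        using elim by (simp add: scaleR_R algebra_simps)
    qed
    then have "t *\<^sub>R A + t *\<^sub>R (A * A * R s) = t *\<^sub>R (s\<^sup>2 *\<^sub>R R s - of_real s)"
      by (simp add: scaleR_add_right)
    then have "t *\<^sub>R A + t *\<^sub>R (A * A * R s) = of_real (- (s * t)) + (t * s\<^sup>2) *\<^sub>R R s"
      by (simp add: of_real_def scaleR_diff_right mult.commute[of s t])
    moreover have "exp (t *\<^sub>R A + t *\<^sub>R (A * A * R s)) = exp (t *\<^sub>R A) * exp (t *\<^sub>R (A * A * R s))"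
      using comm by (intro exp_add_commuting) simp
    moreover have "exp (of_real (- (s * t)) + (t * s\<^sup>2) *\<^sub>R R s)
        = exp (of_real (- (s * t))) * exp ((t * s\<^sup>2) *\<^sub>R R s)"
      by (intro exp_add_commuting) (simp add: of_real_def)
    moreover have "exp (of_real (- (s * t)) :: 'a) * X = exp (- (s * t)) *\<^sub>R X" for X :: 'a
      by (simp only: exp_of_real flip: scaleR_conv_of_real)
    ultimately show ?case
      by simp
  qed
qed

text \<open>The resolvent identity gives the derivative once \<open>R\<close> is known to be continuous; continuity in turn
follows from the same identity and the local bound \<open>\<parallel>R(u)\<parallel> \<le> 2 \<parallel>R(s)\<parallel>\<close>.\<close>
lemma R_has_vector_derivative:
  assumes "s > 0"
  shows "(R has_vector_derivative - (R s * R s)) (at s)"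
proof -
  have diff: "R u - R s = (s - u) *\<^sub>R (R u * R s)" if "u > 0" for u
  proof -
    have "R u - R s = R u * ((of_real s - A) * R s) - R u * (of_real u - A) * R s"
      using that assms by (simp add: right_inverse left_inverse)
    also have "\<dots> = R u * (of_real (s - u)) * R s"
      by (simp add: algebra_simps)
    finally show ?thesis
      by (simp add: of_real_def)
  qed
  have pos: "\<forall>\<^sub>F u in at s. u > 0"
    using assms by (auto simp: eventually_at_topological intro!: exI[of _ "{0<..}"])
  have bound: "\<forall>\<^sub>F u in at s. norm (R u) \<le> 2 * norm (R s)"
  proof -
    have "((\<lambda>u. \<bar>s - u\<bar> * norm (R s)) \<longlongrightarrow> \<bar>s - s\<bar> * norm (R s)) (at s)"
      by (intro tendsto_intros)
    then have "\<forall>\<^sub>F u in at s. \<bar>s - u\<bar> * norm (R s) < 1 / 2"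
      by (rule order_tendstoD) simp
    with pos show ?thesis
    proof eventually_elim
      case (elim u)
      have "norm (R u) \<le> norm (R s) + norm (R u - R s)"
        by (metis norm_triangle_sub)
      also have "norm (R u - R s) \<le> \<bar>s - u\<bar> * (norm (R u) * norm (R s))"
        using elim by (simp add: diff mult_left_mono norm_mult_ineq)
      also have "\<dots> = norm (R u) * (\<bar>s - u\<bar> * norm (R s))"
        by simp
      also have "\<dots> \<le> norm (R u) * (1 / 2)"
        using elim by (intro mult_left_mono) auto
      finally show ?case
        by simp
    qed
  qed
  have "((\<lambda>u. R u - R s) \<longlongrightarrow> 0) (at s)"
  proof (rule Lim_null_comparison)
    show "\<forall>\<^sub>F u in at s. norm (R u - R s) \<le> \<bar>s - u\<bar> * (2 * norm (R s) * norm (R s))"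
      using pos bound
    proof eventually_elim
      case (elim u)
      have "norm (R u * R s) \<le> 2 * norm (R s) * norm (R s)"
        using elim by (intro order_trans[OF norm_mult_ineq] mult_right_mono) auto
      with elim show ?case
        by (simp add: diff mult_left_mono)
    qed
    have "((\<lambda>u. \<bar>s - u\<bar> * (2 * norm (R s) * norm (R s))) \<longlongrightarrow> \<bar>s - s\<bar> * (2 * norm (R s) * norm (R s))) (at s)"
      by (intro tendsto_intros)
    then show "((\<lambda>u. \<bar>s - u\<bar> * (2 * norm (R s) * norm (R s))) \<longlongrightarrow> 0) (at s)"
      by simp
  qed
  then have "(R \<longlongrightarrow> R s) (at s)"
    by (simp add: LIM_zero_iff)
  then have "((\<lambda>u. - (R u * R s)) \<longlongrightarrow> - (R s * R s)) (at s)"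
    by (intro tendsto_intros)
  then have "((\<lambda>u. (R u - R s) /\<^sub>R (u - s)) \<longlongrightarrow> - (R s * R s)) (at s)"
  proof (rule Lim_transform_eventually)
    show "\<forall>\<^sub>F u in at s. - (R u * R s) = (R u - R s) /\<^sub>R (u - s)"
      using pos eventually_neq_at_within[of s s UNIV]
    proof eventually_elim
      case (elim u)
      then have "inverse (u - s) * (s - u) = -1"
        by (simp add: field_simps)
      with elim show ?case
        by (simp add: diff)
    qed
  qed
  then show ?thesis
    by (rule has_vector_derivativeI_quotient)
qed

end

section \<open>Positivity and mass of the kernel\<close>

definition ray :: "'a::real_normed_vector \<Rightarrow> 'a set" where
  "ray B = {r *\<^sub>R B | r. r \<ge> 0}"

text \<open>This description as an equation between continuous functions makes closedness of the ray immediate.\<close>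
lemma ray_eq: "B \<noteq> 0 \<Longrightarrow> ray B = {X. norm X *\<^sub>R B = norm B *\<^sub>R X}"
proof (intro equalityI subsetI)
  fix X assume "B \<noteq> 0" and X: "X \<in> {X. norm X *\<^sub>R B = norm B *\<^sub>R X}"
  then have "X = (1 / norm B) *\<^sub>R (norm X *\<^sub>R B)"
    by simp
  then have "X = (norm X / norm B) *\<^sub>R B"
    by simp
  then show "X \<in> ray B"
    unfolding ray_def by (metis (mono_tags, lifting) divide_nonneg_nonneg mem_Collect_eq norm_ge_zero)
qed (auto simp: ray_def)

lemma closed_ray: "B \<noteq> 0 \<Longrightarrow> closed (ray B)"
  by (simp add: ray_eq closed_Collect_eq continuous_intros)

lemma ray_add: "X \<in> ray B \<Longrightarrow> Y \<in> ray B \<Longrightarrow> X + Y \<in> ray B"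
  unfolding ray_def by (auto, metis add_nonneg_nonneg scaleR_add_left)

lemma ray_scaleR: "X \<in> ray B \<Longrightarrow> c \<ge> 0 \<Longrightarrow> c *\<^sub>R X \<in> ray B"
  unfolding ray_def by auto

lemma zero_in_ray: "0 \<in> ray B"
  unfolding ray_def by (auto intro!: exI[of _ 0])

context positive_resolvent
begin

text \<open>Differentiating \<open>B R(s) B = f(s) B\<close> repeatedly, where each derivative of \<open>R(s)\<^sup>n\<^sup>+\<^sup>1\<close> is
\<open>-(n + 1) R(s)\<^sup>n\<^sup>+\<^sup>2\<close>: complete monotonicity of \<open>f\<close> becomes nonnegativity of all these scalars.\<close>
lemma sandwiched_power_R:
  assumes cm: "completely_monotonic f"
    and f: "\<And>s. s > 0 \<Longrightarrow> B * R s * B = f s *\<^sub>R B"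
    and s: "s > 0"
  shows "B * R s ^ Suc n * B = ((- 1) ^ n * (deriv ^^ n) f s / fact n) *\<^sub>R B"
  using s
proof (induction n arbitrary: s)
  case 0
  then show ?case by (simp add: f)
next
  case (Suc n)
  have power: "((\<lambda>u. R u ^ Suc m) has_vector_derivative (- real (Suc m)) *\<^sub>R R s ^ Suc (Suc m)) (at s)" for m
  proof (induction m)
    case 0
    then show ?case using R_has_vector_derivative[OF Suc.prems] by simp
  next
    case (Suc m)
    have "((\<lambda>u. R u ^ Suc m * R u) has_vector_derivative
        R s ^ Suc m * (- (R s * R s)) + ((- real (Suc m)) *\<^sub>R R s ^ Suc (Suc m)) * R s) (at s)"
      by (intro has_vector_derivative_mult Suc.IH R_has_vector_derivative Suc.prems \<open>s > 0\<close>)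
    moreover have "R s ^ Suc m * (- (R s * R s)) + ((- real (Suc m)) *\<^sub>R R s ^ Suc (Suc m)) * R s
        = (- real (Suc (Suc m))) *\<^sub>R R s ^ Suc (Suc (Suc m))"
      by (simp add: power_Suc2 mult.assoc algebra_simps scaleR_2 del: power_Suc)
    ultimately show ?case
      by (simp add: power_Suc2 del: power_Suc)
  qed
  have lhs: "((\<lambda>u. B * R u ^ Suc n * B) has_vector_derivative
      B * ((- real (Suc n)) *\<^sub>R R s ^ Suc (Suc n)) * B) (at s)"
    by (intro derivative_intros power)
  have "(deriv ^^ n) f differentiable (at s)"
    using cm Suc.prems by (simp add: completely_monotonic_def)
  then have "((deriv ^^ n) f has_real_derivative (deriv ^^ Suc n) f s) (at s)"
    by (simp add: DERIV_deriv_iff_real_differentiable)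
  then have "((\<lambda>u. (- 1) ^ n * (deriv ^^ n) f u / fact n) has_real_derivative
      (- 1) ^ n * (deriv ^^ Suc n) f s / fact n) (at s)"
    by (intro derivative_eq_intros) auto
  then have "((\<lambda>u. ((- 1) ^ n * (deriv ^^ n) f u / fact n) *\<^sub>R B) has_vector_derivative
      ((- 1) ^ n * (deriv ^^ Suc n) f s / fact n) *\<^sub>R B) (at s)"
    unfolding has_real_derivative_iff_has_vector_derivative
    by (rule bounded_linear.has_vector_derivative[OF bounded_linear_scaleR_left])
  then have "((\<lambda>u. B * R u ^ Suc n * B) has_vector_derivative
      ((- 1) ^ n * (deriv ^^ Suc n) f s / fact n) *\<^sub>R B) (at s)"
    by (rule has_vector_derivative_transform_within_open[of _ _ _ "{0<..}"])
      (use Suc.IH Suc.prems in auto)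
  from vector_derivative_unique_at[OF lhs this]
  have "(- real (Suc n)) *\<^sub>R (B * R s ^ Suc (Suc n) * B) = ((- 1) ^ n * (deriv ^^ Suc n) f s / fact n) *\<^sub>R B"
    by (simp del: power_Suc funpow.simps)
  note scaled = this
  have "B * R s ^ Suc (Suc n) * B = (- 1 / real (Suc n) * - real (Suc n)) *\<^sub>R (B * R s ^ Suc (Suc n) * B)"
    by (simp del: of_nat_Suc power_Suc)
  also have "\<dots> = (- 1 / real (Suc n) * ((- 1) ^ n * (deriv ^^ Suc n) f s / fact n)) *\<^sub>R B"
    by (simp only: scaled flip: scaleR_scaleR)
  also have "- 1 / real (Suc n) * ((- 1) ^ n * (deriv ^^ Suc n) f s / fact n)
      = (- 1) ^ Suc n * (deriv ^^ Suc n) f s / fact (Suc n)"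
    by (simp add: field_simps del: funpow.simps)
  finally show ?case .
qed

text \<open>The exponential of a nonnegative multiple of \<open>R(s)\<close> and then, by the Yosida approximation, \<open>exp(t A)\<close>
are limits of nonnegative combinations of powers of resolvents, and the ray is a closed convex cone.
The zeroth power is the limit of \<open>s R(s)\<close>.\<close>
lemma sandwiched_exp_in_ray:
  assumes B: "B \<noteq> 0" and t: "t \<ge> 0"
    and R: "\<And>s k. s > 0 \<Longrightarrow> B * R s ^ Suc k * B \<in> ray B"
  shows "B * exp (t *\<^sub>R A) * B \<in> ray B"
proof -
  have "((\<lambda>s. B * (s *\<^sub>R R s) * B) \<longlongrightarrow> B * 1 * B) at_top"
    by (intro tendsto_intros scaleR_R_tendsto_one)
  moreover have "\<forall>\<^sub>F s in at_top. B * (s *\<^sub>R R s) * B \<in> ray B"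
    using eventually_gt_at_top[of 0]
  proof eventually_elim
    case (elim s)
    then show ?case
      using ray_scaleR[OF R[of s 0], of s] by simp
  qed
  ultimately have "B * 1 * B \<in> ray B"
    using Lim_in_closed_set[OF closed_ray[OF B]] by force
  then have pow: "B * R s ^ k * B \<in> ray B" if "s > 0" for s k
    using R[OF that, of "k - 1"] by (cases k) auto
  have exp_in: "B * exp (c *\<^sub>R R s) * B \<in> ray B" if "s > 0" "c \<ge> 0" for s c
  proof -
    have partial: "B * (\<Sum>k<n. (c *\<^sub>R R s) ^ k /\<^sub>R fact k) * B \<in> ray B" for n
    proof (induction n)
      case (Suc n)
      have "B * ((c *\<^sub>R R s) ^ n /\<^sub>R fact n) * B = (c ^ n / fact n) *\<^sub>R (B * R s ^ n * B)"
        by (simp add: scaleR_power divide_inverse mult.commute)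
      then have "B * ((c *\<^sub>R R s) ^ n /\<^sub>R fact n) * B \<in> ray B"
        using that by (simp add: ray_scaleR pow)
      then show ?case
        using ray_add[OF Suc.IH] by (simp add: algebra_simps)
    qed (simp add: zero_in_ray)
    have "(\<lambda>n. (\<Sum>k<n. (c *\<^sub>R R s) ^ k /\<^sub>R fact k)) \<longlonglongrightarrow> exp (c *\<^sub>R R s)"
      using exp_converges[of "c *\<^sub>R R s"] by (simp add: sums_def)
    then have "(\<lambda>n. B * (\<Sum>k<n. (c *\<^sub>R R s) ^ k /\<^sub>R fact k) * B) \<longlonglongrightarrow> B * exp (c *\<^sub>R R s) * B"
      by (intro tendsto_intros)
    then show ?thesis
      by (rule closed_sequentially[OF closed_ray[OF B], rotated]) (rule partial)
  qed
  have "((\<lambda>s. B * (exp (- (s * t)) *\<^sub>R exp ((t * s\<^sup>2) *\<^sub>R R s)) * B) \<longlongrightarrow> B * exp (t *\<^sub>R A) * B) at_top"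
    by (intro tendsto_intros exp_eq_limit_Yosida)
  moreover have "\<forall>\<^sub>F s in at_top. B * (exp (- (s * t)) *\<^sub>R exp ((t * s\<^sup>2) *\<^sub>R R s)) * B \<in> ray B"
    using eventually_gt_at_top[of 0]
  proof eventually_elim
    case (elim s)
    then show ?case
      using ray_scaleR[OF exp_in[of s "t * s\<^sup>2"], of "exp (- (s * t))"] t by simp
  qed
  ultimately show ?thesis
    using Lim_in_closed_set[OF closed_ray[OF B]] by force
qed

text \<open>A truncated Laplace transform of the exponential: the integrand is the derivative of \<open>- exp(-s u) R(s) exp(u A)\<close>.\<close>
lemma integral_discounted_exp:
  assumes s: "s > 0" and t: "t \<ge> 0"
  shows "((\<lambda>u. exp (- (s * u)) *\<^sub>R exp (u *\<^sub>R A)) has_integral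
    (R s - exp (- (s * t)) *\<^sub>R (R s * exp (t *\<^sub>R A)))) {0..t}"
proof -
  let ?F = "\<lambda>u. - (exp (- (s * u)) *\<^sub>R (R s * exp (u *\<^sub>R A)))"
  have "((\<lambda>u. exp (- (s * u)) *\<^sub>R exp (u *\<^sub>R A)) has_integral (?F t - ?F 0)) {0..t}"
  proof (rule fundamental_theorem_of_calculus[OF t])
    fix u
    have "((\<lambda>u. exp (- (s * u))) has_real_derivative - s * exp (- (s * u))) (at u within {0..t})"
      by (auto intro!: derivative_eq_intros)
    then have "(?F has_vector_derivative
        - (exp (- (s * u)) *\<^sub>R (R s * (A * exp (u *\<^sub>R A))) + (- s * exp (- (s * u))) *\<^sub>R (R s * exp (u *\<^sub>R A))))
        (at u within {0..t})"
      by (intro has_vector_derivative_minus has_vector_derivative_scaleR has_vector_derivative_mult_right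
          has_vector_derivative_at_within[OF exp_scaleR_has_vector_derivative_left])
    moreover have "- (exp (- (s * u)) *\<^sub>R (R s * (A * exp (u *\<^sub>R A))) + (- s * exp (- (s * u))) *\<^sub>R (R s * exp (u *\<^sub>R A)))
        = exp (- (s * u)) *\<^sub>R (R s * (of_real s - A) * exp (u *\<^sub>R A))"
      by (simp add: algebra_simps of_real_def)
    ultimately show "(?F has_vector_derivative exp (- (s * u)) *\<^sub>R exp (u *\<^sub>R A)) (at u within {0..t})"
      using s by (simp add: left_inverse)
  qed
  then show ?thesis
    by simp
qed

text \<open>The discounted integral of \<open>h\<close> over all of the half-line is the scalar of \<open>B R(s) B\<close>, which is at most \<open>1\<close>;
since \<open>h \<ge> 0\<close> this bounds the discounted integral over \<open>{0..t}\<close>, and the discount disappears as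
\<open>s\<close> tends to \<open>0\<close>.\<close>
lemma integral_kernel_le_one:
  assumes B: "B \<noteq> 0"
    and h: "\<And>u. u \<ge> 0 \<Longrightarrow> B * exp (u *\<^sub>R A) * B = h u *\<^sub>R B"
    and h_nonneg: "\<And>u. u \<ge> 0 \<Longrightarrow> h u \<ge> 0" and h_cont: "continuous_on {0..} h"
    and bound: "\<And>u. u \<ge> 0 \<Longrightarrow> norm (exp (u *\<^sub>R A)) \<le> M"
    and RB: "\<And>s. s > 0 \<Longrightarrow> norm (B * R s * B) \<le> norm B"
    and t: "t \<ge> 0"
  shows "integral {0..t} h \<le> 1"
proof -
  have int: "(\<lambda>u. exp (- (s * u)) * h u) integrable_on {a..b}" if "a \<ge> 0" for s a b
    using that by (intro integrable_continuous_real continuous_intros continuous_on_subset[OF h_cont]) auto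
  have discounted: "integral {0..t} (\<lambda>u. exp (- (s * u)) * h u) \<le> 1" if s: "s > 0" for s
  proof -
    \<comment> \<open>Integrating up to \<open>T\<close> instead of \<open>t\<close> leaves an error that vanishes as \<open>T\<close> tends to infinity.\<close>
    have "norm B * integral {0..t} (\<lambda>u. exp (- (s * u)) * h u)
        \<le> norm B + exp (- (s * T)) * (norm B * norm (R s) * M * norm B)" if T: "T \<ge> t" for T
    proof -
      have "((\<lambda>u. B * (exp (- (s * u)) *\<^sub>R exp (u *\<^sub>R A)) * B) has_integral
          B * (R s - exp (- (s * T)) *\<^sub>R (R s * exp (T *\<^sub>R A))) * B) {0..T}"
        using integral_discounted_exp[OF s, of T] t T
        by (intro has_integral_mult_left has_integral_mult_right) auto
      then have "((\<lambda>u. (exp (- (s * u)) * h u) *\<^sub>R B) has_integral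
          (B * R s * B - exp (- (s * T)) *\<^sub>R (B * (R s * exp (T *\<^sub>R A)) * B))) {0..T}"
        by (rule has_integral_eq_rhs[OF has_integral_eq, rotated]) (auto simp: h[unfolded mult.assoc] algebra_simps)
      moreover have "((\<lambda>u. (exp (- (s * u)) * h u) *\<^sub>R B) has_integral
          integral {0..T} (\<lambda>u. exp (- (s * u)) * h u) *\<^sub>R B) {0..T}"
        by (intro has_integral_scaleR_left integrable_integral int) auto
      ultimately have eq: "integral {0..T} (\<lambda>u. exp (- (s * u)) * h u) *\<^sub>R B
          = B * R s * B - exp (- (s * T)) *\<^sub>R (B * (R s * exp (T *\<^sub>R A)) * B)"
        using has_integral_unique by blast
      have "integral {0..t} (\<lambda>u. exp (- (s * u)) * h u) \<le> integral {0..T} (\<lambda>u. exp (- (s * u)) * h u)"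
        using T by (intro integral_subset_le int) (auto simp: h_nonneg)
      then have "norm B * integral {0..t} (\<lambda>u. exp (- (s * u)) * h u)
          \<le> norm (integral {0..T} (\<lambda>u. exp (- (s * u)) * h u) *\<^sub>R B)"
        by (simp add: mult.commute[of "norm B"] mult_right_mono)
      also have "\<dots> \<le> norm (B * R s * B) + exp (- (s * T)) * norm (B * (R s * exp (T *\<^sub>R A)) * B)"
        unfolding eq by (rule order_trans[OF norm_triangle_ineq4]) simp
      also have "norm (B * (R s * exp (T *\<^sub>R A)) * B) \<le> norm B * (norm (R s) * M) * norm B"
        using t T bound[of T]
        by (intro order_trans[OF norm_mult_ineq] mult_mono mult_left_mono mult_right_mono) (auto intro: mult_nonneg_nonneg order_trans[OF norm_ge_zero])
      finally show ?thesis
        using RB[OF s] by (simp add: mult.assoc)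
    qed
    then have "\<forall>\<^sub>F T in at_top. norm B * integral {0..t} (\<lambda>u. exp (- (s * u)) * h u)
        \<le> norm B + exp (- (s * T)) * (norm B * norm (R s) * M * norm B)"
      by (rule eventually_mono[OF eventually_ge_at_top[of t]])
    moreover have "((\<lambda>T. exp (- (s * T))) \<longlongrightarrow> 0) at_top"
      using s by real_asymp
    then have "((\<lambda>T. norm B + exp (- (s * T)) * (norm B * norm (R s) * M * norm B))
        \<longlongrightarrow> norm B + 0 * (norm B * norm (R s) * M * norm B)) at_top"
      by (intro tendsto_intros)
    ultimately have "norm B * integral {0..t} (\<lambda>u. exp (- (s * u)) * h u) \<le> norm B"
      using tendsto_lowerbound trivial_limit_at_top_linorder by fastforce
    then show ?thesis
      using B by simp
  qed
  have "exp (- (s * t)) * integral {0..t} h \<le> 1" if s: "s > 0" for s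
  proof -
    have "exp (- (s * t)) * integral {0..t} h = integral {0..t} (\<lambda>u. exp (- (s * t)) * h u)"
      by simp
    also have "\<dots> \<le> integral {0..t} (\<lambda>u. exp (- (s * u)) * h u)"
      using int[of 0 0 t] s
      by (intro integral_le int) (auto intro!: mult_right_mono h_nonneg integrable_on_mult_right)
    finally show ?thesis
      using discounted[OF s] by linarith
  qed
  then have ev: "\<forall>\<^sub>F s in at_right 0. exp (- (s * t)) * integral {0..t} h \<le> 1"
    by (auto simp: eventually_at_filter)
  have lim: "((\<lambda>s. exp (- (s * t)) * integral {0..t} h) \<longlongrightarrow> exp (- (0 * t)) * integral {0..t} h) (at_right 0)"
    by (intro tendsto_intros)
  have "exp (- (0 * t)) * integral {0..t} h \<le> 1"
    by (rule tendsto_upperbound[OF lim ev]) simp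
  then show ?thesis
    by simp
qed

end

section \<open>Exponential stability of matrices\<close>

lemma norm_complex_scale: "norm (c *s v) = cmod c * norm (v :: complex^'m)"
proof -
  have "norm (c *s v) = L2_set (\<lambda>i. cmod c * norm (v $ i)) UNIV"
    by (simp add: norm_vec_def norm_mult)
  also have "\<dots> = cmod c * norm v"
    by (simp add: norm_vec_def L2_set_right_distrib)
  finally show ?thesis .
qed

lemma bounded_bilinear_complex_scale: "bounded_bilinear ((*s) :: complex \<Rightarrow> complex^'m \<Rightarrow> complex^'m)"
proof
  show "\<exists>K. \<forall>c v. norm (c *s v :: complex^'m) \<le> norm c * norm v * K"
    by (rule exI[of _ 1]) (simp add: norm_complex_scale)
qed (simp_all add: vec_eq_iff algebra_simps)

lemma linear_relation_exists:
  fixes x :: "nat \<Rightarrow> 'a::euclidean_space"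
  shows "\<exists>n r. (\<exists>k\<le>n. r k \<noteq> 0) \<and> (\<Sum>k\<le>n. r k *\<^sub>R x k) = 0"
proof -
  define n where "n = DIM('a)"
  show ?thesis
  proof (cases "inj_on x {..n}")
    case False
    then obtain i j where ij: "i \<le> n" "j \<le> n" "i \<noteq> j" "x i = x j"
      by (auto simp: inj_on_def)
    define r where "r = (\<lambda>k. if k = i then 1 else if k = j then - 1 else 0 :: real)"
    have "(\<Sum>k\<le>n. r k *\<^sub>R x k) = (\<Sum>k\<in>{i, j}. r k *\<^sub>R x k)"
      using ij by (intro sum.mono_neutral_right) (auto simp: r_def)
    also have "\<dots> = 0"
      using ij by (simp add: r_def)
    finally show ?thesis
      using ij by (intro exI[of _ n] exI[of _ r]) (auto simp: r_def intro!: exI[of _ i])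
  next
    case True
    then have "card (x ` {..n}) > DIM('a)"
      by (simp add: card_image n_def)
    then have "dependent (x ` {..n})"
      by (intro dependent_biggerset) auto
    then obtain u where u: "\<exists>v\<in>x ` {..n}. u v \<noteq> 0" "(\<Sum>v\<in>x ` {..n}. u v *\<^sub>R v) = 0"
      by (auto simp: real_vector.dependent_finite)
    have "(\<Sum>k\<le>n. u (x k) *\<^sub>R x k) = 0"
      using u(2) by (simp add: sum.reindex[OF True])
    then show ?thesis
      using u(1) by (intro exI[of _ n] exI[of _ "\<lambda>k. u (x k)"]) auto
  qed
qed

text \<open>This is \<open>q(M) v\<close>, evaluated by Horner's scheme.\<close>
definition poly_act :: "complex^'m^'m \<Rightarrow> complex poly \<Rightarrow> complex^'m \<Rightarrow> complex^'m" where
  "poly_act M q v = fold_coeffs (\<lambda>c w. c *s v + M *v w) q 0"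

lemma poly_act_0 [simp]: "poly_act M 0 v = 0"
  by (simp add: poly_act_def)

lemma poly_act_pCons [simp]: "poly_act M (pCons c q) v = c *s v + M *v poly_act M q v"
  by (cases "c = 0 \<and> q = 0") (auto simp: poly_act_def)

lemma poly_act_add: "poly_act M (p + q) v = poly_act M p v + poly_act M q v"
  by (induction p q rule: poly_induct2)
    (simp_all add: matrix_vector_right_distrib vec.scale_left_distrib)

lemma poly_act_sum: "poly_act M (sum f I) v = (\<Sum>i\<in>I. poly_act M (f i) v)"
  by (induction I rule: infinite_finite_induct) (simp_all add: poly_act_add)

lemma poly_act_smult: "poly_act M (smult c q) v = c *s poly_act M q v"
  by (induction q) (simp_all add: vec.scale_right_distrib vector_scalar_commute)

lemma poly_act_monom: "poly_act M (monom c k) v = c *s (((*v) M) ^^ k) v"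
  by (induction k) (simp_all add: monom_0 monom_Suc vector_scalar_commute)

lemma poly_act_linear_factor:
  "poly_act M ([:- a, 1:] * q) v = M *v poly_act M q v - a *s poly_act M q v"
proof -
  have "[:- a, 1:] * q = pCons 0 q + smult (- a) q"
    by simp
  then show ?thesis
    by (simp only: poly_act_add poly_act_smult poly_act_pCons) simp
qed

lemma poly_act_shift:
  "poly_act M q (M *v v - a *s v) = M *v poly_act M q v - a *s poly_act M q v"
proof (induction q)
  case (pCons c q)
  show ?case
    unfolding poly_act_pCons pCons.IH matrix_vector_right_distrib matrix_vector_mult_diff_distrib
      vector_scalar_commute vec.scale_right_distrib vec.scale_right_diff_distrib
    by (simp add: algebra_simps)
qed simp

lemma mat_mult_vector: "mat a *v (v :: complex^'m) = a *s v"
  by (simp add: vec_eq_iff matrix_vector_mult_def mat_def if_distrib[of "\<lambda>x. x * y" for y] cong: if_cong)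

text \<open>The vectors \<open>v, M v, M\<^sup>2 v, \<dots>\<close> lie in a finite-dimensional space, so finitely many of them are dependent.\<close>
lemma annihilating_poly_exists:
  fixes v :: "complex^'m"
  shows "\<exists>q. q \<noteq> 0 \<and> poly_act M q v = 0"
proof -
  obtain n r where r: "\<exists>k\<le>n. r k \<noteq> (0::real)" "(\<Sum>k\<le>n. r k *\<^sub>R (((*v) M) ^^ k) v) = 0"
    using linear_relation_exists[of "\<lambda>k. (((*v) M) ^^ k) v"] by blast
  define q where "q = (\<Sum>k\<le>n. monom (complex_of_real (r k)) k)"
  have "complex_of_real c *s w = c *\<^sub>R w" for c and w :: "complex^'m"
    by (simp add: vec_eq_iff scaleR_conv_of_real[where 'a = complex])
  then have "poly_act M q v = 0"
    using r(2) by (simp add: q_def poly_act_sum poly_act_monom)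
  moreover obtain k where "k \<le> n" "r k \<noteq> 0"
    using r(1) by blast
  then have "coeff q k \<noteq> 0"
    by (simp add: q_def coeff_sum)
  then have "q \<noteq> 0"
    by auto
  ultimately show ?thesis
    by blast
qed

definition decays :: "complex^'m^'m \<Rightarrow> complex^'m \<Rightarrow> bool" where
  "decays M v \<longleftrightarrow> (\<exists>b>0. \<exists>C. \<forall>t\<ge>0. norm (app (exp (t *\<^sub>R endo_of_matrix M)) v) \<le> C * exp (- (b * t)))"

lemma app_exp_has_vector_derivative:
  "((\<lambda>t. app (exp (t *\<^sub>R endo_of_matrix M)) v) has_vector_derivative
     app (exp (t *\<^sub>R endo_of_matrix M)) (M *v v)) (at t within S)"
proof -
  have "((\<lambda>t. app (exp (t *\<^sub>R endo_of_matrix M)) v) has_vector_derivative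
      app (exp (t *\<^sub>R endo_of_matrix M) * endo_of_matrix M) v) (at t within S)"
    by (rule bounded_linear.has_vector_derivative[OF app.bounded_linear_left
          exp_scaleR_has_vector_derivative_right])
  then show ?thesis
    by (simp add: app_mult)
qed

text \<open>Members of the endomorphism algebra are only real-linear, so complex linearity of the exponential has to
be read off from its series.\<close>
lemma app_exp_complex_scale:
  fixes v :: "complex^'m"
  shows "app (exp (t *\<^sub>R endo_of_matrix M)) (c *s v) = c *s app (exp (t *\<^sub>R endo_of_matrix M)) v"
proof -
  interpret sc: bounded_bilinear "(*s) :: complex \<Rightarrow> complex^'m \<Rightarrow> complex^'m"
    by (rule bounded_bilinear_complex_scale)
  let ?A = "endo_of_matrix M"
  have pow: "app (?A ^ n) (c *s w) = c *s app (?A ^ n) w" for n w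
    by (induction n arbitrary: w) (simp_all add: app_mult app_one vector_scalar_commute)
  have term_eq: "app ((t *\<^sub>R ?A) ^ n /\<^sub>R fact n) (c *s v) = c *s app ((t *\<^sub>R ?A) ^ n /\<^sub>R fact n) v" for n
    by (simp only: scaleR_power app.scaleR_left pow sc.scaleR_right)
  have s: "(\<lambda>n. (t *\<^sub>R ?A) ^ n /\<^sub>R fact n) sums exp (t *\<^sub>R ?A)"
    by (rule exp_converges)
  have "(\<lambda>n. app ((t *\<^sub>R ?A) ^ n /\<^sub>R fact n) (c *s v)) sums app (exp (t *\<^sub>R ?A)) (c *s v)"
    by (rule bounded_linear.sums[OF app.bounded_linear_left s])
  moreover have "(\<lambda>n. c *s app ((t *\<^sub>R ?A) ^ n /\<^sub>R fact n) v) sums (c *s app (exp (t *\<^sub>R ?A)) v)"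
    by (intro bounded_linear.sums[OF sc.bounded_linear_right] bounded_linear.sums[OF app.bounded_linear_left s])
  ultimately show ?thesis
    unfolding term_eq by (rule sums_unique2)
qed

text \<open>The function \<open>f(t) = exp(-a t) E(t) v\<close> has derivative \<open>exp(-a t) E(t) (M v - a v)\<close>. The rate \<open>b\<close> is at
most the rate of \<open>M v - a v\<close> and strictly smaller than \<open>- Re a\<close>, so that the bound on \<open>f'\<close> is a growing
exponential and integrates without polynomial factors.\<close>
lemma decays_step:
  fixes v :: "complex^'m"
  assumes "decays M (M *v v - a *s v)" and a: "Re a < 0"
  shows "decays M v"
proof -
  interpret sc: bounded_bilinear "(*s) :: complex \<Rightarrow> complex^'m \<Rightarrow> complex^'m"
    by (rule bounded_bilinear_complex_scale)
  let ?E = "\<lambda>t. app (exp (t *\<^sub>R endo_of_matrix M))"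
  obtain b' C where b': "b' > 0" and C': "\<And>t. t \<ge> 0 \<Longrightarrow> norm (?E t (M *v v - a *s v)) \<le> C * exp (- (b' * t))"
    using assms(1) unfolding decays_def by blast
  define b where "b = min b' (- Re a / 2)"
  have b: "b > 0" "b \<le> b'" "Re a + b < 0"
    using b' a by (auto simp: b_def)
  have "C \<ge> 0"
    using order_trans[OF norm_ge_zero C'[of 0]] by simp
  have C: "norm (?E t (M *v v - a *s v)) \<le> C * exp (- (b * t))" if "t \<ge> 0" for t
  proof -
    have "exp (- (b' * t)) \<le> exp (- (b * t))"
      using b(2) that by (simp add: mult_right_mono)
    from mult_left_mono[OF this \<open>C \<ge> 0\<close>] show ?thesis
      using C'[OF that] by linarith
  qed
  define \<delta> where "\<delta> = - Re a - b"
  have \<delta>: "\<delta> > 0"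
    using b by (simp add: \<delta>_def)
  define f where "f = (\<lambda>t. exp (- a * of_real t) *s ?E t v)"
  have f': "(f has_vector_derivative exp (- a * of_real t) *s ?E t (M *v v - a *s v)) (at t)" for t
  proof -
    have "((\<lambda>t. exp (- a * of_real t)) has_vector_derivative (- a) * exp (- a * of_real t)) (at t)"
    proof -
      have "((\<lambda>z. exp (- a * z)) has_field_derivative (- a) * exp (- a * of_real t)) (at (of_real t))"
        by (auto intro!: derivative_eq_intros)
      then show ?thesis
        by (rule has_vector_derivative_real_field)
    qed
    from sc.has_vector_derivative[OF this app_exp_has_vector_derivative]
    have "(f has_vector_derivative exp (- a * of_real t) *s ?E t (M *v v) + ((- a) * exp (- a * of_real t)) *s ?E t v) (at t)"
      unfolding f_def .
    moreover have "exp (- a * of_real t) *s ?E t (M *v v) + ((- a) * exp (- a * of_real t)) *s ?E t v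
        = exp (- a * of_real t) *s ?E t (M *v v - a *s v)"
      by (simp add: app.diff_right app_exp_complex_scale vec_eq_iff algebra_simps)
    ultimately show ?thesis
      by simp
  qed
  have bound: "norm (?E t v) \<le> (norm v + C / \<delta>) * exp (- (b * t))" if t: "t \<ge> 0" for t
  proof (cases "t = 0")
    case True
    then show ?thesis
      using \<open>C \<ge> 0\<close> \<delta> by (simp add: app_one)
  next
    case False
    have "norm (f t - f 0) \<le> C / \<delta> * exp (\<delta> * t) - C / \<delta> * exp (\<delta> * 0)"
    proof (rule differentiable_bound_general)
      show "0 < t"
        using False t by simp
      show "continuous_on {0..t} f"
        by (rule continuous_on_vector_derivative, rule has_vector_derivative_at_within[OF f'])
      show "continuous_on {0..t} (\<lambda>t. C / \<delta> * exp (\<delta> * t))"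
        by (intro continuous_intros)
      show "(f has_vector_derivative exp (- a * of_real u) *s ?E u (M *v v - a *s v)) (at u)" for u
        by (rule f')
      show "((\<lambda>t. C / \<delta> * exp (\<delta> * t)) has_vector_derivative C * exp (\<delta> * u)) (at u)" for u
        using \<delta> by (auto intro!: derivative_eq_intros simp flip: has_real_derivative_iff_has_vector_derivative)
      show "norm (exp (- a * of_real u) *s ?E u (M *v v - a *s v)) \<le> C * exp (\<delta> * u)" if "0 < u" "u < t" for u
      proof -
        have "norm (exp (- a * of_real u) *s ?E u (M *v v - a *s v))
            \<le> exp (- Re a * u) * (C * exp (- (b * u)))"
          using C[of u] that by (simp add: norm_complex_scale)
        also have "\<dots> = C * exp (\<delta> * u)"
          by (simp add: \<delta>_def algebra_simps flip: exp_add)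
        finally show ?thesis .
      qed
    qed
    then have "norm (f t) \<le> norm v + C / \<delta> * exp (\<delta> * t)"
      using \<open>C \<ge> 0\<close> \<delta> norm_triangle_sub[of "f t" "f 0"] by (simp add: f_def app_one) (smt (verit) divide_nonneg_pos)
    moreover have "norm (f t) = exp (- Re a * t) * norm (?E t v)"
      by (simp add: f_def norm_complex_scale)
    ultimately have "exp (Re a * t) * (exp (- Re a * t) * norm (?E t v)) \<le> exp (Re a * t) * (norm v + C / \<delta> * exp (\<delta> * t))"
      by (intro mult_left_mono) auto
    moreover have "exp (Re a * t) * (exp (- Re a * t) * norm (?E t v)) = norm (?E t v)"
      by (simp flip: mult.assoc exp_add)
    moreover have "exp (Re a * t) * (C / \<delta> * exp (\<delta> * t)) = C / \<delta> * exp (- (b * t))"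
      by (simp add: \<delta>_def algebra_simps flip: exp_add)
    moreover have "exp (Re a * t) * norm v \<le> exp (- (b * t)) * norm v"
      using mult_right_mono[of "Re a" "- b" t] b(3) t by (intro mult_right_mono) auto
    ultimately show ?thesis
      unfolding distrib_left distrib_right mult.commute[of "norm v"] by linarith
  qed
  then show ?thesis
    using b(1) unfolding decays_def by blast
qed

text \<open>Splitting off a root \<open>a\<close> of \<open>q\<close>: if \<open>a\<close> is in the spectrum, the cofactor annihilates \<open>M v - a v\<close> and
the previous lemma applies; otherwise \<open>M - a\<close> is injective and the cofactor annihilates \<open>v\<close> itself.\<close>
lemma decays_of_annihilated:
  assumes "matrix_spectrum M \<subseteq> {z. Re z < 0}"
  shows "q \<noteq> 0 \<Longrightarrow> poly_act M q v = 0 \<Longrightarrow> decays M v"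
proof (induction "degree q" arbitrary: q v)
  case 0
  then obtain c where "q = [:c:]" "c \<noteq> 0"
    by (metis degree_eq_zeroE pCons_eq_0_iff)
  then have "v = 0"
    using 0 by simp
  then show ?case
    unfolding decays_def by (intro exI[of _ 1] conjI exI[of _ 0]) (auto simp: app.zero_right)
next
  case (Suc n)
  then have "\<not> constant (poly q)"
    by (simp add: constant_degree)
  then obtain a where "poly q a = 0"
    using fundamental_theorem_of_algebra by blast
  then obtain q1 where q1: "q = [:- a, 1:] * q1"
    by (auto simp: poly_eq_0_iff_dvd)
  with Suc have q1': "q1 \<noteq> 0" "degree q1 = n"
    by (auto simp: degree_mult_eq simp del: mult_pCons_left)
  show ?case
  proof (cases "a \<in> matrix_spectrum M")
    case True
    have "poly_act M q1 (M *v v - a *s v) = 0"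
      using Suc.prems(2) unfolding q1 poly_act_linear_factor poly_act_shift .
    then have "decays M (M *v v - a *s v)"
      using Suc.hyps(1) q1' by blast
    then show ?thesis
      by (rule decays_step) (use assms True in auto)
  next
    case False
    define w where "w = poly_act M q1 v"
    have "M *v w - a *s w = 0"
      using Suc.prems(2) unfolding q1 poly_act_linear_factor w_def .
    then have "(mat a - M) *v w = 0"
      by (simp add: matrix_vector_mult_diff_rdistrib mat_mult_vector)
    moreover have "invertible (mat a - M)"
      using False by (simp add: matrix_spectrum_def matrix_resolvent_set_def)
    ultimately have "w = 0"
      by (metis invertible_def matrix_vector_mul_assoc matrix_vector_mul_lid matrix_vector_mult_0_right)
    then show ?thesis
      using Suc.hyps(1)[of q1 v] q1' by (simp add: w_def)
  qed
qed

text \<open>The rate is the smallest of the rates of the finitely many basis vectors.\<close>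
lemma exp_endo_exponentially_stable:
  fixes M :: "complex^'m^'m"
  assumes "matrix_spectrum M \<subseteq> {z. Re z < 0}"
  obtains b C where "b > 0" "\<And>t. t \<ge> 0 \<Longrightarrow> norm (exp (t *\<^sub>R endo_of_matrix M)) \<le> C * exp (- (b * t))"
proof -
  let ?E = "\<lambda>t. exp (t *\<^sub>R endo_of_matrix M)"
  have "decays M v" for v
    using annihilating_poly_exists decays_of_annihilated[OF assms] by blast
  then have "\<forall>v. \<exists>b C. b > 0 \<and> (\<forall>t\<ge>0. norm (app (?E t) v) \<le> C * exp (- (b * t)))"
    unfolding decays_def by blast
  then obtain \<beta> \<Gamma> where \<beta>: "\<And>v. \<beta> v > 0"
    and \<Gamma>: "\<And>v t. t \<ge> 0 \<Longrightarrow> norm (app (?E t) v) \<le> \<Gamma> v * exp (- (\<beta> v * t))"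
    by metis
  define b where "b = Min (\<beta> ` (Basis :: (complex^'m) set))"
  have b: "b > 0" "\<And>v. v \<in> Basis \<Longrightarrow> b \<le> \<beta> v"
    using \<beta> by (auto simp: b_def)
  have "norm (?E t) \<le> (\<Sum>v\<in>Basis. \<Gamma> v) * exp (- (b * t))" if t: "t \<ge> 0" for t
  proof -
    have "norm (?E t) \<le> (\<Sum>v\<in>Basis. norm (app (?E t) v))"
      by (rule norm_endo_le_sum_Basis)
    also have "\<dots> \<le> (\<Sum>v\<in>Basis. \<Gamma> v * exp (- (b * t)))"
    proof (rule sum_mono)
      fix v :: "complex^'m" assume v: "v \<in> Basis"
      have "\<Gamma> v \<ge> 0"
        using order_trans[OF norm_ge_zero \<Gamma>[of 0 v]] by simp
      then have "\<Gamma> v * exp (- (\<beta> v * t)) \<le> \<Gamma> v * exp (- (b * t))"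
        using b(2)[OF v] t by (intro mult_left_mono) (auto intro: mult_right_mono)
      then show "norm (app (?E t) v) \<le> \<Gamma> v * exp (- (b * t))"
        using \<Gamma>[OF t, of v] by linarith
    qed
    finally show ?thesis
      by (simp add: sum_distrib_right)
  qed
  then show ?thesis
    using that b(1) by blast
qed

section \<open>A renewal estimate\<close>

definition conv :: "(real \<Rightarrow> real) \<Rightarrow> (real \<Rightarrow> real) \<Rightarrow> real \<Rightarrow> real" where
  "conv f g t = integral {0..t} (\<lambda>s. f (t - s) * g s)"

lemma conv_integrable:
  fixes f g :: "real \<Rightarrow> real"
  assumes "continuous_on {0..} f" "continuous_on {0..} g" and "t \<ge> 0"
  shows "(\<lambda>s. f (t - s) * g s) integrable_on {0..t}"
proof (intro integrable_continuous_real continuous_intros)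
  show "continuous_on {0..t} (\<lambda>s. f (t - s))"
    by (rule continuous_on_compose2[OF assms(1)]) (auto intro!: continuous_intros)
  show "continuous_on {0..t} g"
    by (rule continuous_on_subset[OF assms(2)]) auto
qed

lemma continuous_on_conv:
  assumes f: "continuous_on {0..} f" and g: "continuous_on {0..} g"
  shows "continuous_on {0..} (conv f g)"
proof -
  \<comment> \<open>Rescaling to the unit interval moves the dependence on \<open>t\<close> from the domain into the integrand.\<close>
  have eq: "t * integral {0..1} (\<lambda>u. f (t * (1 - u)) * g (t * u)) = conv f g t" if "t \<ge> 0" for t
  proof (cases "t = 0")
    case False
    with that have "t > 0"
      by simp
    have "((\<lambda>s. f (t - s) * g s) has_integral conv f g t) (cbox 0 t)"
      using conv_integrable[OF f g that] by (simp add: conv_def has_integral_integral)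
    from has_integral_affinity'[OF this \<open>t > 0\<close>, of 0]
    have "((\<lambda>u. f (t * (1 - u)) * g (t * u)) has_integral conv f g t / t) {0..1}"
      using \<open>t > 0\<close> by (simp add: algebra_simps divide_inverse)
    then show ?thesis
      using \<open>t > 0\<close> by (simp add: integral_unique)
  qed (simp add: conv_def)
  have "continuous_on ({0..} \<times> cbox 0 1) (\<lambda>(t, u). f (t * (1 - u)) * g (t * u))"
    unfolding case_prod_beta
    by (intro continuous_intros continuous_on_compose2[OF f] continuous_on_compose2[OF g]) auto
  from integral_continuous_on_param[OF this]
  have "continuous_on {0..} (\<lambda>t. t * integral {0..1} (\<lambda>u. f (t * (1 - u)) * g (t * u)))"
    by (intro continuous_intros) simp
  then show ?thesis
    by (rule continuous_on_eq) (simp add: eq)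
qed

lemma integral_reverse:
  fixes F :: "real \<Rightarrow> real"
  assumes "t \<ge> 0"
  shows "integral {0..t} (\<lambda>s. F (t - s)) = integral {0..t} F"
proof -
  have img: "(\<lambda>x. t - x) ` {0..t} = {0..t}"
    by (auto simp: image_iff intro!: bexI[of _ "t - _"])
  have hi: "((\<lambda>s. G (t - s)) has_integral I) {0..t}" if "(G has_integral I) {0..t}" for G :: "real \<Rightarrow> real" and I
    using has_integral_affinity[of G I 0 t "-1" t] that img by simp
  show ?thesis
  proof (cases "F integrable_on {0..t}")
    case True
    then show ?thesis
      using hi by (blast intro: integral_unique integrable_integral)
  next
    case False
    moreover have "\<not> (\<lambda>s. F (t - s)) integrable_on {0..t}"
      using False hi[of "\<lambda>s. F (t - s)"] by (auto simp: integrable_on_def)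
    ultimately show ?thesis
      by (simp add: not_integrable_integral)
  qed
qed

lemma conv_mono:
  assumes "continuous_on {0..} f" "continuous_on {0..} g" "continuous_on {0..} g'"
    and "\<And>s. s \<ge> 0 \<Longrightarrow> f s \<ge> 0" "\<And>s. s \<ge> 0 \<Longrightarrow> g s \<le> g' s" and "t \<ge> 0"
  shows "conv f g t \<le> conv f g' t"
  unfolding conv_def using assms
  by (intro integral_le conv_integrable mult_left_mono) auto

lemma conv_sum_right:
  assumes "finite I" "continuous_on {0..} f" "\<And>i. i \<in> I \<Longrightarrow> continuous_on {0..} (g i)" and "t \<ge> 0"
  shows "conv f (\<lambda>s. \<Sum>i\<in>I. g i s) t = (\<Sum>i\<in>I. conv f (g i) t)"
  unfolding conv_def sum_distrib_left using assms by (intro integral_sum conv_integrable) auto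

primrec renewal_term :: "(real \<Rightarrow> real) \<Rightarrow> real \<Rightarrow> nat \<Rightarrow> real \<Rightarrow> real" where
  "renewal_term h b 0 = (\<lambda>t. exp (- (b * t)))"
| "renewal_term h b (Suc n) = conv h (renewal_term h b n)"

lemma continuous_on_renewal_term:
  "continuous_on {0..} h \<Longrightarrow> continuous_on {0..} (renewal_term h b n)"
  by (induction n) (auto intro!: continuous_intros continuous_on_conv)

lemma renewal_term_nonneg:
  assumes "continuous_on {0..} h" "\<And>s. s \<ge> 0 \<Longrightarrow> h s \<ge> 0"
  shows "t \<ge> 0 \<Longrightarrow> renewal_term h b n t \<ge> 0"
proof (induction n arbitrary: t)
  case (Suc n)
  then show ?case
    using conv_mono[OF assms(1) continuous_on_const[of _ 0] continuous_on_renewal_term[OF assms(1), of b n]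
        assms(2), of t] by (simp add: conv_def)
qed simp

text \<open>The partial sums \<open>v\<^sub>N\<close> satisfy \<open>v\<^sub>N\<^sub>+\<^sub>1 = exp(-b t) + h * v\<^sub>N\<close>, and the right-hand side is monotone in \<open>v\<^sub>N\<close>
because \<open>h \<ge> 0\<close>.\<close>
lemma sum_renewal_term_le_supersolution:
  assumes h: "continuous_on {0..} h" "\<And>s. s \<ge> 0 \<Longrightarrow> h s \<ge> 0"
    and w: "continuous_on {0..} w" "\<And>t. t \<ge> 0 \<Longrightarrow> w t \<ge> 0"
    and super: "\<And>t. t \<ge> 0 \<Longrightarrow> exp (- (b * t)) + conv h w t \<le> w t"
  shows "t \<ge> 0 \<Longrightarrow> (\<Sum>n<N. renewal_term h b n t) \<le> w t"
proof (induction N arbitrary: t)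
  case (Suc N)
  have "(\<Sum>n<Suc N. renewal_term h b n t) = exp (- (b * t)) + (\<Sum>n<N. conv h (renewal_term h b n) t)"
    by (simp only: sum.lessThan_Suc_shift renewal_term.simps)
  also have "(\<Sum>n<N. conv h (renewal_term h b n) t) = conv h (\<lambda>s. \<Sum>n<N. renewal_term h b n s) t"
    using Suc.prems by (intro conv_sum_right[symmetric] h continuous_on_renewal_term) auto
  also have "\<dots> \<le> conv h w t"
    using Suc by (intro conv_mono h w continuous_on_sum continuous_on_renewal_term) auto
  finally show ?case
    using super[OF Suc.prems] by linarith
qed (simp add: w)

text \<open>Let \<open>H(t)\<close> be the integral of \<open>h\<close> over \<open>{0..t}\<close>. The constant \<open>1\<close> satisfies \<open>1 - h * 1 = 1 - H\<close>, which is at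
least \<open>1/2\<close> on a short interval \<open>{0..\<delta>}\<close> but may tend to \<open>0\<close>, so constants need not be supersolutions.
Superposing delayed copies of the constant with weights \<open>b exp(-b r)\<close> produces \<open>1 - exp(-b t)\<close>, whose
defect is \<open>exp(-b t) F(t)\<close> with
\[ F(t) = \int_0^t b\, e^{b u}\,(1 - H(u))\, du . \]
As \<open>F\<close> is nondecreasing and \<open>F(\<delta>) \<ge> b \<delta> / 2\<close>, this defect dominates a multiple of \<open>exp(-b t)\<close> for
\<open>t \<ge> \<delta>\<close>, while the constant takes care of \<open>t \<le> \<delta>\<close>. Hence a combination of both is a
bounded supersolution.\<close>
lemma renewal_sum_bounded:
  assumes h: "continuous_on {0..} h" "\<And>s. s \<ge> 0 \<Longrightarrow> h s \<ge> 0"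
    and mass: "\<And>t. t \<ge> 0 \<Longrightarrow> integral {0..t} h \<le> 1"
    and b: "b > 0"
  obtains C where "C \<ge> 0" "\<And>t N. t \<ge> 0 \<Longrightarrow> (\<Sum>n<N. renewal_term h b n t) \<le> C"
proof -
  define H where "H = (\<lambda>t. integral {0..t} h)"
  define L where "L = (\<lambda>t. integral {0..t} (\<lambda>u. exp (b * u) * h u))"
  have cont_h: "continuous_on {0..t} h" for t
    by (rule continuous_on_subset[OF h(1)]) auto
  have H': "(H has_vector_derivative h u) (at u within {0..t})" if "0 \<le> u" "u \<le> t" for u t
    unfolding H_def using that by (intro integral_has_vector_derivative cont_h) auto
  have L': "(L has_vector_derivative exp (b * u) * h u) (at u within {0..t})" if "0 \<le> u" "u \<le> t" for u t
    unfolding L_def using that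
    by (intro integral_has_vector_derivative[of 0 t "\<lambda>u. exp (b * u) * h u"] continuous_intros cont_h) auto
  obtain \<delta> where \<delta>: "\<delta> > 0" and H_small: "\<And>u. 0 \<le> u \<Longrightarrow> u \<le> \<delta> \<Longrightarrow> H u \<le> 1 / 2"
  proof -
    have "bounded (h ` {0..1})"
      by (intro compact_imp_bounded compact_continuous_image cont_h) simp
    then obtain K where K: "K > 0" "\<And>u. 0 \<le> u \<Longrightarrow> u \<le> 1 \<Longrightarrow> h u \<le> K"
      by (force simp: bounded_pos)
    show ?thesis
    proof
      show "min 1 (1 / (2 * K)) > 0"
        using K by simp
      fix u assume u: "0 \<le> u" "u \<le> min 1 (1 / (2 * K))"
      have "H u \<le> integral {0..u} (\<lambda>_. K)"
        unfolding H_def using u K by (intro integral_le integrable_continuous_real cont_h) auto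
      also have "\<dots> \<le> 1 / 2"
        using u K by (simp add: field_simps)
      finally show "H u \<le> 1 / 2" .
    qed
  qed
  define F where "F = (\<lambda>t. exp (b * t) * (1 - H t) - 1 + L t)"
  have F: "((\<lambda>u. b * exp (b * u) * (1 - H u)) has_integral F t) {0..t}" if "t \<ge> 0" for t
  proof -
    have "((\<lambda>u. b * exp (b * u) * (1 - H u)) has_integral F t - F 0) {0..t}"
    proof (rule fundamental_theorem_of_calculus[OF that])
      fix u assume u: "u \<in> {0..t}"
      have "(H has_real_derivative h u) (at u within {0..t})"
        "(L has_real_derivative exp (b * u) * h u) (at u within {0..t})"
        using H' L' u by (auto simp: has_real_derivative_iff_has_vector_derivative)
      then have "(F has_real_derivative b * exp (b * u) * (1 - H u)) (at u within {0..t})"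
        unfolding F_def by (auto intro!: derivative_eq_intros simp: algebra_simps)
      then show "(F has_vector_derivative b * exp (b * u) * (1 - H u)) (at u within {0..t})"
        by (simp add: has_real_derivative_iff_has_vector_derivative)
    qed
    then show ?thesis
      by (simp add: F_def H_def L_def)
  qed
  have K_nonneg: "1 - H u \<ge> 0" if "u \<ge> 0" for u
    using mass that by (simp add: H_def)
  have F_nonneg: "F t \<ge> 0" if "t \<ge> 0" for t
    by (rule has_integral_nonneg[OF F[OF that]]) (use K_nonneg b in auto)
  have F_large: "F t \<ge> b * \<delta> / 2" if "t \<ge> \<delta>" for t
  proof -
    have "b * \<delta> / 2 = integral {0..\<delta>} (\<lambda>u. b / 2)"
      using \<delta> by simp
    also have "\<dots> \<le> integral {0..\<delta>} (\<lambda>u. b * exp (b * u) * (1 - H u))"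
    proof (rule integral_le)
      fix u assume u: "u \<in> {0..\<delta>}"
      have "b * 1 * (1 / 2) \<le> b * exp (b * u) * (1 - H u)"
        using u b H_small[of u] by (intro mult_mono) auto
      then show "b / 2 \<le> b * exp (b * u) * (1 - H u)"
        by simp
    qed (use F[of \<delta>] \<delta> in \<open>auto simp: integrable_on_def\<close>)
    also have "\<dots> \<le> integral {0..t} (\<lambda>u. b * exp (b * u) * (1 - H u))"
      using that \<delta> F[of t] F[of \<delta>] b
      by (intro integral_subset_le) (auto simp: integrable_on_def intro!: mult_nonneg_nonneg K_nonneg)
    also have "\<dots> = F t"
      using F[of t] that \<delta> by (simp add: integral_unique)
    finally show ?thesis .
  qed
  \<comment> \<open>With this weight, the lower bound \<open>b \<delta> / 2\<close> for \<open>F\<close> gives \<open>c exp(-b t) F(t) \<ge> exp(-b t) / 2\<close> for \<open>t \<ge> \<delta>\<close>; the factor \<open>2\<close> in \<open>w\<close> makes up for the half.\<close>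
  define c where "c = 1 / (b * \<delta>)"
  have c: "c > 0"
    using b \<delta> by (simp add: c_def)
  define w where "w = (\<lambda>t. 2 * (1 + c * (1 - exp (- (b * t)))))"
  have w_cont: "continuous_on {0..} w"
    unfolding w_def by (intro continuous_intros)
  have w_conv: "w t - conv h w t = 2 * ((1 - H t) + c * (exp (- (b * t)) * F t))" if t: "t \<ge> 0" for t
  proof -
    have "conv h w t = integral {0..t} (\<lambda>s. (\<lambda>u. 2 * (1 + c) * h u - 2 * c * exp (- (b * t)) * (exp (b * u) * h u)) (t - s))"
      unfolding conv_def w_def by (intro integral_cong) (simp add: algebra_simps flip: exp_add)
    also have "\<dots> = integral {0..t} (\<lambda>u. 2 * (1 + c) * h u - 2 * c * exp (- (b * t)) * (exp (b * u) * h u))"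
      by (rule integral_reverse[OF t])
    also have "\<dots> = 2 * (1 + c) * H t - 2 * c * exp (- (b * t)) * L t"
      unfolding H_def L_def
      by (subst integral_diff) (auto intro!: integrable_continuous_real continuous_intros cont_h)
    finally have conv: "conv h w t = 2 * (1 + c) * H t - 2 * c * exp (- (b * t)) * L t" .
    have eF: "exp (- (b * t)) * F t = 1 - H t - exp (- (b * t)) + exp (- (b * t)) * L t"
      by (simp add: F_def algebra_simps exp_minus_inverse flip: exp_add mult.assoc)
    then show ?thesis
      unfolding conv eF unfolding w_def by (simp add: algebra_simps)
  qed
  have super: "exp (- (b * t)) + conv h w t \<le> w t" if t: "t \<ge> 0" for t
  proof -
    have "exp (- (b * t)) \<le> 2 * ((1 - H t) + c * (exp (- (b * t)) * F t))"
    proof (cases "t \<le> \<delta>")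
      case True
      have "exp (- (b * t)) \<le> 1"
        using b t by simp
      moreover have "c * (exp (- (b * t)) * F t) \<ge> 0"
        using c F_nonneg[OF t] by simp
      ultimately show ?thesis
        using H_small[OF t True] by argo
    next
      case False
      then have "c * (exp (- (b * t)) * (b * \<delta> / 2)) \<le> c * (exp (- (b * t)) * F t)"
        using c F_large[of t] by (intro mult_left_mono) auto
      moreover have "c * (exp (- (b * t)) * (b * \<delta> / 2)) = exp (- (b * t)) / 2"
        using b \<delta> by (simp add: c_def)
      ultimately show ?thesis
        using K_nonneg[OF t] by argo
    qed
    then show ?thesis
      using w_conv[OF t] by simp
  qed
  have w_bounds: "0 \<le> w t" "w t \<le> 2 * (1 + c)" if "t \<ge> 0" for t
    using that b c by (auto simp: w_def)
  have "(\<Sum>n<N. renewal_term h b n t) \<le> 2 * (1 + c)" if "t \<ge> 0" for t N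
    using sum_renewal_term_le_supersolution[OF h w_cont w_bounds(1) super that, of N] w_bounds(2)[OF that]
    by linarith
  then show ?thesis
    using that[of "2 * (1 + c)"] c by simp
qed

section \<open>The sequence spaces\<close>

lemma powr_convex_nonneg:
  fixes u v :: real
  assumes r: "r \<ge> 1" and uv: "u \<ge> 0" "v \<ge> 0" and lm: "l \<ge> 0" "m \<ge> 0" "l + m = 1"
  shows "(l * u + m * v) powr r \<le> l * u powr r + m * v powr r"
proof -
  have scale: "(c * w) powr r \<le> c * w powr r" if "0 \<le> c" "c \<le> 1" "w \<ge> 0" for c w :: real
  proof -
    have "c powr r \<le> c powr 1"
      using that r by (intro powr_mono') auto
    then show ?thesis
      using that by (simp add: powr_mult mult_right_mono)
  qed
  have l: "l = 1 - m"
    using lm by simp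
  consider "u = 0" | "v = 0" | "u > 0" "v > 0"
    using uv by linarith
  then show ?thesis
  proof cases
    case 3
    then show ?thesis
      using convex_onD[OF powr_convex[OF r], of m u v] lm by (simp add: algebra_simps l)
  qed (use scale[of m v] scale[of l u] lm uv in auto)
qed

text \<open>Membership in a ball of the sequence space, tested on the first \<open>n\<close> entries. By lemma \<open>lp_ball_iff\<close> all
facts about the norm reduce to such finite tests, where no question of convergence arises.\<close>
definition lp_within :: "ennreal \<Rightarrow> real \<Rightarrow> (nat \<Rightarrow> complex^'m) \<Rightarrow> nat \<Rightarrow> bool" where
  "lp_within p C x n \<longleftrightarrow>
     (if p = \<infinity> then \<forall>k<n. norm (x k) \<le> C
      else (\<Sum>k<n. norm (x k) powr enn2real p) \<le> C powr enn2real p)"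

lemma one_le_enn2real: "1 \<le> p \<Longrightarrow> p \<noteq> \<infinity> \<Longrightarrow> 1 \<le> enn2real p"
  using enn2real_mono[of 1 p] by (simp add: less_top)

lemma lp_ball_iff:
  assumes p: "1 \<le> p" and C: "0 \<le> C"
  shows "x \<in> lp_space p \<and> lp_norm p x \<le> C \<longleftrightarrow> (\<forall>n. lp_within p C x n)"
proof (cases "p = \<infinity>")
  case True
  have "bounded (range x) \<and> (SUP k. norm (x k)) \<le> C \<longleftrightarrow> (\<forall>k. norm (x k) \<le> C)"
  proof
    assume *: "bounded (range x) \<and> (SUP k. norm (x k)) \<le> C"
    then have "bdd_above (range (\<lambda>k. norm (x k)))"
      by (auto simp: bounded_iff bdd_above_def)
    then show "\<forall>k. norm (x k) \<le> C"
      using * by (meson cSUP_upper UNIV_I order_trans)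
  next
    assume "\<forall>k. norm (x k) \<le> C"
    then show "bounded (range x) \<and> (SUP k. norm (x k)) \<le> C"
      by (auto simp: bounded_iff intro!: cSUP_least)
  qed
  then show ?thesis
    using True by (auto simp: lp_space_def lp_norm_def lp_within_def)
next
  case False
  define r where "r = enn2real p"
  have r: "r \<ge> 1"
    using one_le_enn2real[OF p False] by (simp add: r_def)
  define S where "S = (\<Sum>k. norm (x k) powr r)"
  have "summable (\<lambda>k. norm (x k) powr r) \<and> S powr (1 / r) \<le> C
      \<longleftrightarrow> (\<forall>n. (\<Sum>k<n. norm (x k) powr r) \<le> C powr r)"
  proof
    assume *: "summable (\<lambda>k. norm (x k) powr r) \<and> S powr (1 / r) \<le> C"
    then have "S \<ge> 0"
      by (auto simp: S_def intro: suminf_nonneg)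
    then have "S = (S powr (1 / r)) powr r"
      using r by (simp add: powr_powr)
    also have "\<dots> \<le> C powr r"
      using * r by (intro powr_mono2) auto
    finally have "S \<le> C powr r" .
    moreover have "(\<Sum>k<n. norm (x k) powr r) \<le> S" for n
      unfolding S_def using * by (intro sum_le_suminf) auto
    ultimately show "\<forall>n. (\<Sum>k<n. norm (x k) powr r) \<le> C powr r"
      using order_trans by blast
  next
    assume *: "\<forall>n. (\<Sum>k<n. norm (x k) powr r) \<le> C powr r"
    then have sm: "summable (\<lambda>k. norm (x k) powr r)"
      by (intro summableI_nonneg_bounded) auto
    have "S \<le> C powr r"
      unfolding S_def using * by (intro suminf_le_const sm) auto
    moreover have "S \<ge> 0"
      unfolding S_def by (intro suminf_nonneg sm) auto
    ultimately have "S powr (1 / r) \<le> (C powr r) powr (1 / r)"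
      using r by (intro powr_mono2) auto
    also have "\<dots> = C"
      using r C by (simp add: powr_powr)
    finally show "summable (\<lambda>k. norm (x k) powr r) \<and> S powr (1 / r) \<le> C"
      using sm by blast
  qed
  then show ?thesis
    using False by (simp add: lp_space_def lp_norm_def lp_within_def S_def r_def)
qed

lemma lp_within_mono:
  assumes p: "1 \<le> p" and "\<And>k. norm (y k) \<le> norm (x k)" "lp_within p C x n"
  shows "lp_within p C y n"
proof (cases "p = \<infinity>")
  case False
  then have "(\<Sum>k<n. norm (y k) powr enn2real p) \<le> (\<Sum>k<n. norm (x k) powr enn2real p)"
    using assms(2) one_le_enn2real[OF p False] by (intro sum_mono powr_mono2) auto
  then show ?thesis
    using assms(3) False by (simp add: lp_within_def)
qed (use assms in \<open>auto simp: lp_within_def intro: order_trans\<close>)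

text \<open>Minkowski's inequality for finitely many entries: with \<open>l = a / (a + b)\<close> and \<open>m = b / (a + b)\<close>, convexity of
the power function is applied to the convex combination of \<open>\<parallel>x\<^sub>k\<parallel> / a\<close> and \<open>\<parallel>y\<^sub>k\<parallel> / b\<close>.\<close>
lemma lp_within_add:
  assumes p: "1 \<le> p" and a: "0 \<le> a" and b: "0 \<le> b"
    and x: "lp_within p a x n" and y: "lp_within p b y n"
  shows "lp_within p (a + b) (\<lambda>k. x k + y k) n"
proof (cases "p = \<infinity>")
  case True
  then show ?thesis
    using x y by (auto simp: lp_within_def intro: norm_triangle_mono)
next
  case False
  define r where "r = enn2real p"
  have r: "r \<ge> 1"
    using one_le_enn2real[OF p False] by (simp add: r_def)
  have X: "(\<Sum>k<n. norm (x k) powr r) \<le> a powr r" and Y: "(\<Sum>k<n. norm (y k) powr r) \<le> b powr r"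
    using x y False by (auto simp: lp_within_def r_def)
  have null: "\<forall>k<n. z k = 0" if "(\<Sum>k<n. norm (z k) powr r) \<le> 0 powr r" for z :: "nat \<Rightarrow> complex^'m"
  proof -
    have "(\<Sum>k<n. norm (z k) powr r) = 0"
      using that by (intro antisym sum_nonneg) auto
    then show ?thesis
      by (subst (asm) sum_nonneg_eq_0_iff) auto
  qed
  have "(\<Sum>k<n. norm (x k + y k) powr r) \<le> (a + b) powr r"
  proof -
    consider "a = 0" | "b = 0" | "a > 0" "b > 0"
      using a b by linarith
    then show ?thesis
    proof cases
      case 1
      then have "\<forall>k<n. x k = 0"
        using X by (intro null) simp
      then have "(\<Sum>k<n. norm (x k + y k) powr r) = (\<Sum>k<n. norm (y k) powr r)"
        by simp
      then show ?thesis
        using Y 1 by simp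
    next
      case 2
      then have "\<forall>k<n. y k = 0"
        using Y by (intro null) simp
      then have "(\<Sum>k<n. norm (x k + y k) powr r) = (\<Sum>k<n. norm (x k) powr r)"
        by simp
      then show ?thesis
        using X 2 by simp
    next
      case 3
      define l m where "l = a / (a + b)" and "m = b / (a + b)"
      have lm: "l \<ge> 0" "m \<ge> 0" "l + m = 1"
        using 3 by (auto simp: l_def m_def simp flip: add_divide_distrib)
      have term_le: "norm (x k + y k) powr r
          \<le> (a + b) powr r * (l * (norm (x k) powr r / a powr r) + m * (norm (y k) powr r / b powr r))" for k
      proof -
        have "norm (x k + y k) powr r \<le> (norm (x k) + norm (y k)) powr r"
          using r by (intro powr_mono2 norm_triangle_ineq) auto
        also have "norm (x k) + norm (y k) = (a + b) * (l * (norm (x k) / a) + m * (norm (y k) / b))"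
        proof -
          have "(a + b) * l = a" "(a + b) * m = b"
            using 3 by (auto simp: l_def m_def)
          moreover have "(a + b) * (l * (norm (x k) / a) + m * (norm (y k) / b))
              = (a + b) * l * (norm (x k) / a) + (a + b) * m * (norm (y k) / b)"
            by (simp only: distrib_left mult.assoc)
          ultimately show ?thesis
            using 3 by simp
        qed
        also have "\<dots> powr r = (a + b) powr r * (l * (norm (x k) / a) + m * (norm (y k) / b)) powr r"
          by (rule powr_mult)
        also have "\<dots> \<le> (a + b) powr r * (l * (norm (x k) / a) powr r + m * (norm (y k) / b) powr r)"
          using 3 lm r by (intro mult_left_mono powr_convex_nonneg) auto
        finally show ?thesis
          using 3 by (simp add: powr_divide)
      qed
      have "(\<Sum>k<n. norm (x k + y k) powr r)
          \<le> (\<Sum>k<n. (a + b) powr r * (l * (norm (x k) powr r / a powr r) + m * (norm (y k) powr r / b powr r)))"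
        by (intro sum_mono term_le)
      also have "\<dots> = (a + b) powr r * (l * ((\<Sum>k<n. norm (x k) powr r) / a powr r)
          + m * ((\<Sum>k<n. norm (y k) powr r) / b powr r))"
        by (simp add: sum.distrib sum_divide_distrib sum_distrib_left distrib_left)
      also have "\<dots> \<le> (a + b) powr r * (l * 1 + m * 1)"
        using X Y 3 lm by (intro mult_left_mono add_mono) auto
      finally show ?thesis
        using lm by simp
    qed
  qed
  then show ?thesis
    using False by (simp add: lp_within_def r_def)
qed

lemma lp_within_limit:
  assumes "\<And>i. lp_within p C (X i) n" and lim: "\<And>k. (\<lambda>i. X i k) \<longlonglongrightarrow> x k" and p: "1 \<le> p"
  shows "lp_within p C x n"
proof (cases "p = \<infinity>")
  case True
  then show ?thesis
    using assms(1) by (auto simp: lp_within_def intro!: LIMSEQ_le_const2[OF tendsto_norm[OF lim]])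
next
  case False
  have "(\<lambda>i. \<Sum>k<n. norm (X i k) powr enn2real p) \<longlonglongrightarrow> (\<Sum>k<n. norm (x k) powr enn2real p)"
    using one_le_enn2real[OF p False]
    by (intro tendsto_sum tendsto_powr' tendsto_norm lim tendsto_const) auto
  then show ?thesis
    using assms(1) False by (auto simp: lp_within_def intro: LIMSEQ_le_const2)
qed

definition shift :: "(nat \<Rightarrow> 'a::zero) \<Rightarrow> nat \<Rightarrow> 'a" where
  "shift x k = (case k of 0 \<Rightarrow> 0 | Suc j \<Rightarrow> x j)"

lemma lp_within_shift:
  assumes "\<And>n. lp_within p C x n" and "0 \<le> C"
  shows "lp_within p C (shift x) n"
proof (cases "p = \<infinity>")
  case True
  then show ?thesis
    using assms(1)[of n] assms(2) by (auto simp: lp_within_def shift_def split: nat.split)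
next
  case False
  have "(\<Sum>k<n. norm (shift x k) powr enn2real p) = (\<Sum>k<n - 1. norm (x k) powr enn2real p)"
    by (cases n) (simp_all add: sum.lessThan_Suc_shift shift_def del: sum.lessThan_Suc)
  then show ?thesis
    using assms(1)[of "n - 1"] False by (simp add: lp_within_def)
qed

lemma funpow_shift: "(shift ^^ n) x k = (if k < n then 0 else x (k - n))"
  by (induction n arbitrary: k) (auto simp: shift_def split: nat.split)

context
  fixes p :: ennreal
  assumes p: "1 \<le> p"
begin

lemma lp_norm_nonneg: "x \<in> lp_space p \<Longrightarrow> 0 \<le> lp_norm p (x :: nat \<Rightarrow> complex^'m)"
proof (cases "p = \<infinity>")
  case True
  assume "x \<in> lp_space p"
  then have "bdd_above (range (\<lambda>k. norm (x k)))"
    using True by (auto simp: lp_space_def bounded_iff bdd_above_def)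
  then have "norm (x 0) \<le> (SUP k. norm (x k))"
    by (intro cSUP_upper) auto
  then show ?thesis
    using True order_trans[OF norm_ge_zero] by (simp add: lp_norm_def)
qed (simp add: lp_norm_def)

lemma lp_within_norm: "x \<in> lp_space p \<Longrightarrow> lp_within p (lp_norm p x) (x :: nat \<Rightarrow> complex^'m) n"
  using lp_ball_iff[OF p lp_norm_nonneg] by blast

lemma lp_solid:
  fixes x :: "nat \<Rightarrow> complex^'m"
  assumes "x \<in> lp_space p" "\<And>k. norm (y k) \<le> norm (x k)"
  shows "(y :: nat \<Rightarrow> complex^'m) \<in> lp_space p" "lp_norm p y \<le> lp_norm p x"
  using lp_ball_iff[OF p lp_norm_nonneg[OF assms(1)], of y]
    lp_within_mono[OF p assms(2) lp_within_norm[OF assms(1)]] by auto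

lemma lp_add:
  fixes x :: "nat \<Rightarrow> complex^'m"
  assumes "x \<in> lp_space p" "y \<in> lp_space p"
  shows "(\<lambda>k. x k + y k) \<in> lp_space p" "lp_norm p (\<lambda>k. x k + y k) \<le> lp_norm p x + lp_norm p y"
  using lp_ball_iff[OF p add_nonneg_nonneg[OF lp_norm_nonneg[OF assms(1)] lp_norm_nonneg[OF assms(2)]],
      of "\<lambda>k. x k + y k"]
    lp_within_add[OF p lp_norm_nonneg[OF assms(1)] lp_norm_nonneg[OF assms(2)]
      lp_within_norm[OF assms(1)] lp_within_norm[OF assms(2)]] by auto

lemma lp_zero: "(\<lambda>k. 0 :: complex^'m) \<in> lp_space p" "lp_norm p (\<lambda>k. 0 :: complex^'m) = 0"
proof -
  have "lp_within p 0 (\<lambda>k. 0 :: complex^'m) n" for n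
    by (simp add: lp_within_def)
  then have "(\<lambda>k. 0 :: complex^'m) \<in> lp_space p \<and> lp_norm p (\<lambda>k. 0 :: complex^'m) \<le> 0"
    by (subst lp_ball_iff[OF p]) auto
  then show "(\<lambda>k. 0 :: complex^'m) \<in> lp_space p" "lp_norm p (\<lambda>k. 0 :: complex^'m) = 0"
    using lp_norm_nonneg antisym by blast+
qed

lemma lp_scaleR:
  fixes x :: "nat \<Rightarrow> complex^'m"
  assumes x: "x \<in> lp_space p"
  shows "(\<lambda>k. c *\<^sub>R x k) \<in> lp_space p" "lp_norm p (\<lambda>k. c *\<^sub>R x k) \<le> \<bar>c\<bar> * lp_norm p x"
proof -
  have C: "0 \<le> \<bar>c\<bar> * lp_norm p x"
    using lp_norm_nonneg[OF x] by simp
  have "lp_within p (\<bar>c\<bar> * lp_norm p x) (\<lambda>k. c *\<^sub>R x k) n" for n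
    using lp_within_norm[OF x, of n] lp_norm_nonneg[OF x]
    by (auto simp: lp_within_def powr_mult mult_left_mono simp flip: sum_distrib_left)
  then show "(\<lambda>k. c *\<^sub>R x k) \<in> lp_space p" "lp_norm p (\<lambda>k. c *\<^sub>R x k) \<le> \<bar>c\<bar> * lp_norm p x"
    using lp_ball_iff[OF p C, of "\<lambda>k. c *\<^sub>R x k"] by auto
qed

lemma lp_norm_scaleR:
  fixes x :: "nat \<Rightarrow> complex^'m"
  assumes x: "x \<in> lp_space p"
  shows "lp_norm p (\<lambda>k. c *\<^sub>R x k) = \<bar>c\<bar> * lp_norm p x"
proof (cases "c = 0")
  case False
  have "lp_norm p (\<lambda>k. inverse c *\<^sub>R (c *\<^sub>R x k)) \<le> \<bar>inverse c\<bar> * lp_norm p (\<lambda>k. c *\<^sub>R x k)"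
    by (intro lp_scaleR x)
  then have "\<bar>c\<bar> * lp_norm p x \<le> lp_norm p (\<lambda>k. c *\<^sub>R x k)"
    using False by (simp add: field_simps abs_inverse)
  then show ?thesis
    using lp_scaleR(2)[OF x, of c] by simp
qed (simp add: lp_zero)

lemma lp_diff:
  fixes x :: "nat \<Rightarrow> complex^'m"
  assumes "x \<in> lp_space p" "y \<in> lp_space p"
  shows "(\<lambda>k. x k - y k) \<in> lp_space p" "lp_norm p (\<lambda>k. x k - y k) \<le> lp_norm p x + lp_norm p y"
  using lp_add[OF assms(1) lp_scaleR(1)[OF assms(2), of "- 1"]] lp_scaleR(2)[OF assms(2), of "- 1"] by auto

lemma lp_component: "x \<in> lp_space p \<Longrightarrow> norm (x k) \<le> lp_norm p (x :: nat \<Rightarrow> complex^'m)"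
proof (cases "p = \<infinity>")
  case True
  assume "x \<in> lp_space p"
  from lp_within_norm[OF this, of "Suc k"] True show ?thesis
    by (auto simp: lp_within_def)
next
  case False
  assume x: "x \<in> lp_space p"
  have r: "1 \<le> enn2real p"
    using one_le_enn2real[OF p False] .
  have "norm (x k) powr enn2real p \<le> (\<Sum>k<Suc k. norm (x k) powr enn2real p)"
    by (intro member_le_sum) auto
  also have "\<dots> \<le> lp_norm p x powr enn2real p"
    using lp_within_norm[OF x, of "Suc k"] False by (simp add: lp_within_def)
  finally show ?thesis
    using r lp_norm_nonneg[OF x] powr_less_mono2[of "enn2real p" "lp_norm p x" "norm (x k)"]
    by (cases "norm (x k) \<le> lp_norm p x") auto
qed

text \<open>Balls are closed under entrywise limits, a form of Fatou's lemma; it serves as the completeness of the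
space and as the passage from finite to infinite sums of shifts.\<close>
lemma lp_limit:
  fixes X :: "nat \<Rightarrow> nat \<Rightarrow> complex^'m"
  assumes X: "\<And>i. X i \<in> lp_space p" "\<And>i. lp_norm p (X i) \<le> C"
    and lim: "\<And>k. (\<lambda>i. X i k) \<longlonglongrightarrow> x k"
  shows "x \<in> lp_space p" "lp_norm p x \<le> C"
proof -
  have C: "0 \<le> C"
    using order_trans[OF lp_norm_nonneg[OF X(1)] X(2)] .
  have "lp_within p C (X i) n" for i n
    using lp_ball_iff[OF p C] X by blast
  then have "lp_within p C x n" for n
    by (rule lp_within_limit[OF _ lim p])
  then show "x \<in> lp_space p" "lp_norm p x \<le> C"
    using lp_ball_iff[OF p C] by blast+
qed

lemma lp_shift:
  fixes x :: "nat \<Rightarrow> complex^'m"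
  assumes x: "x \<in> lp_space p"
  shows "(shift ^^ n) x \<in> lp_space p \<and> lp_norm p ((shift ^^ n) x) \<le> lp_norm p x"
proof (induction n)
  case (Suc n)
  then have "lp_within p (lp_norm p x) ((shift ^^ n) x) m" for m
    using lp_ball_iff[OF p lp_norm_nonneg[OF x]] by blast
  then have "lp_within p (lp_norm p x) ((shift ^^ Suc n) x) m" for m
    unfolding funpow.simps comp_apply by (rule lp_within_shift[OF _ lp_norm_nonneg[OF x]])
  then show ?case
    using lp_ball_iff[OF p lp_norm_nonneg[OF x]] by blast
qed (use x in simp)

text \<open>The majorant of \<open>y\<close> is the entrywise limit of the combinations \<open>\<Sum>n<N. \<gamma> n\<close> times the \<open>n\<close>-fold shift of the
sequence of norms of \<open>x\<close>. Shifts are contractions, so the triangle inequality bounds these combinations.\<close>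
lemma lp_young:
  fixes x y :: "nat \<Rightarrow> complex^'m"
  assumes x: "x \<in> lp_space p" and \<gamma>: "\<And>n. \<gamma> n \<ge> 0" "\<And>N. (\<Sum>n<N. \<gamma> n) \<le> C"
    and y: "\<And>k. norm (y k) \<le> (\<Sum>j\<le>k. \<gamma> (k - j) * norm (x j))"
  shows "y \<in> lp_space p" "lp_norm p y \<le> C * lp_norm p x"
proof -
  \<comment> \<open>A unit vector turns the scalar sequence of norms into a sequence of vectors.\<close>
  define e :: "complex^'m" where "e = axis undefined 1"
  have e: "norm e = 1"
    by (simp add: e_def)
  define x' where "x' = (\<lambda>k. norm (x k) *\<^sub>R e)"
  have x': "x' \<in> lp_space p" "lp_norm p x' \<le> lp_norm p x"
    using lp_solid[OF x, of x'] by (auto simp: x'_def e)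
  have "C \<ge> 0"
    using \<gamma>(2)[of 0] by simp
  define Y where "Y = (\<lambda>N k. \<Sum>n<N. \<gamma> n *\<^sub>R (shift ^^ n) x' k)"
  have Y: "Y N \<in> lp_space p \<and> lp_norm p (Y N) \<le> (\<Sum>n<N. \<gamma> n) * lp_norm p x" for N
  proof (induction N)
    case (Suc N)
    have s: "(\<lambda>k. \<gamma> N *\<^sub>R (shift ^^ N) x' k) \<in> lp_space p"
      "lp_norm p (\<lambda>k. \<gamma> N *\<^sub>R (shift ^^ N) x' k) \<le> \<gamma> N * lp_norm p x"
    proof -
      show "(\<lambda>k. \<gamma> N *\<^sub>R (shift ^^ N) x' k) \<in> lp_space p"
        using lp_shift[OF x'(1)] by (intro lp_scaleR) auto
      have "lp_norm p (\<lambda>k. \<gamma> N *\<^sub>R (shift ^^ N) x' k) \<le> \<bar>\<gamma> N\<bar> * lp_norm p ((shift ^^ N) x')"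
        using lp_shift[OF x'(1)] by (intro lp_scaleR) auto
      also have "\<dots> \<le> \<gamma> N * lp_norm p x"
        using lp_shift[OF x'(1), of N] x'(2) \<gamma>(1)[of N] by (auto intro: mult_left_mono)
      finally show "lp_norm p (\<lambda>k. \<gamma> N *\<^sub>R (shift ^^ N) x' k) \<le> \<gamma> N * lp_norm p x" .
    qed
    have "Y (Suc N) = (\<lambda>k. Y N k + \<gamma> N *\<^sub>R (shift ^^ N) x' k)"
      by (simp add: Y_def)
    then show ?case
      using lp_add[OF conjunct1[OF Suc] s(1)] Suc s(2) by (auto simp: algebra_simps)
  qed (simp add: Y_def lp_zero)
  define z where "z = (\<lambda>k. (\<Sum>j\<le>k. \<gamma> (k - j) * norm (x j)) *\<^sub>R e)"
  have Yz: "Y N k = z k" if "N > k" for N k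
  proof -
    have "Y N k = (\<Sum>n\<le>k. \<gamma> n *\<^sub>R (shift ^^ n) x' k)"
      unfolding Y_def using that by (intro sum.mono_neutral_right) (auto simp: funpow_shift)
    also have "\<dots> = (\<Sum>n\<le>k. (\<gamma> n * norm (x (k - n))) *\<^sub>R e)"
      by (intro sum.cong) (auto simp: funpow_shift x'_def)
    also have "\<dots> = (\<Sum>j\<le>k. (\<gamma> (k - j) * norm (x j)) *\<^sub>R e)"
      by (rule sum.reindex_bij_witness[of _ "\<lambda>j. k - j" "\<lambda>j. k - j"]) auto
    finally show ?thesis
      by (simp add: z_def scaleR_sum_left)
  qed
  have "(\<lambda>N. Y N k) \<longlonglongrightarrow> z k" for k
    by (rule tendsto_eventually, rule eventually_mono[OF eventually_gt_at_top[of k]]) (rule Yz)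
  moreover have "lp_norm p (Y N) \<le> C * lp_norm p x" for N
    using Y[of N] mult_right_mono[OF \<gamma>(2)[of N] lp_norm_nonneg[OF x]] by linarith
  ultimately have z: "z \<in> lp_space p" "lp_norm p z \<le> C * lp_norm p x"
    using lp_limit[of Y "C * lp_norm p x" z] Y by blast+
  have "norm (y k) \<le> norm (z k)" for k
    using y[of k] by (simp add: z_def e)
  from lp_solid[OF z(1) this] z(2) show "y \<in> lp_space p" "lp_norm p y \<le> C * lp_norm p x"
    by auto
qed

end

section \<open>Semigroups on the sequence spaces\<close>

lemma of_real_scale_vector: "complex_of_real c *s w = c *\<^sub>R (w :: complex^'m)"
  by (simp add: vec_eq_iff scaleR_conv_of_real[where 'a = complex])

context
  fixes p :: ennreal
  assumes p: "1 \<le> p"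
begin

lemma lp_bounded_operator_props:
  fixes S :: "(nat \<Rightarrow> complex^'m) \<Rightarrow> nat \<Rightarrow> complex^'m"
  assumes S: "lp_bounded_operator p S" and x: "x \<in> lp_space p"
  shows "S x \<in> lp_space p"
    and "y \<in> lp_space p \<Longrightarrow> S (\<lambda>k. x k + y k) = (\<lambda>k. S x k + S y k)"
    and "S (\<lambda>k. c *\<^sub>R x k) = (\<lambda>k. c *\<^sub>R S x k)"
    and "y \<in> lp_space p \<Longrightarrow> S (\<lambda>k. x k - y k) = (\<lambda>k. S x k - S y k)"
proof -
  have add: "S (\<lambda>k. x k + y k) = (\<lambda>k. S x k + S y k)" if "y \<in> lp_space p" for y
    using S x that by (auto simp: lp_bounded_operator_def)
  then show "y \<in> lp_space p \<Longrightarrow> S (\<lambda>k. x k + y k) = (\<lambda>k. S x k + S y k)" .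
  show "S x \<in> lp_space p"
    using S x by (auto simp: lp_bounded_operator_def)
  have scale: "S (\<lambda>k. c *\<^sub>R z k) = (\<lambda>k. c *\<^sub>R S z k)" if "z \<in> lp_space p" for c z
  proof -
    have "S (\<lambda>k. complex_of_real c *s z k) = (\<lambda>k. complex_of_real c *s S z k)"
      using S that unfolding lp_bounded_operator_def by blast
    then show ?thesis
      by (simp add: of_real_scale_vector)
  qed
  from scale[OF x] show "S (\<lambda>k. c *\<^sub>R x k) = (\<lambda>k. c *\<^sub>R S x k)" .
  show "S (\<lambda>k. x k - y k) = (\<lambda>k. S x k - S y k)" if y: "y \<in> lp_space p"
    using add[OF lp_scaleR(1)[OF p y, of "- 1"]] scale[OF y, of "- 1"] by simp
qed

lemma lp_operator_norm_props:
  fixes S :: "(nat \<Rightarrow> complex^'m) \<Rightarrow> nat \<Rightarrow> complex^'m"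
  assumes S: "lp_bounded_operator p S"
  shows "x \<in> lp_space p \<Longrightarrow> lp_norm p (S x) \<le> lp_operator_norm p S * lp_norm p x"
    and "\<theta> < lp_operator_norm p S \<Longrightarrow> \<exists>z\<in>lp_space p. lp_norm p z \<le> 1 \<and> \<theta> < lp_norm p (S z)"
proof -
  let ?B = "{lp_norm p (S x) | x. x \<in> lp_space p \<and> lp_norm p x \<le> 1}"
  obtain C where C: "\<And>x. x \<in> lp_space p \<Longrightarrow> lp_norm p (S x) \<le> C * lp_norm p x"
    using S unfolding lp_bounded_operator_def by blast
  have ne: "?B \<noteq> {}"
    using lp_zero[OF p, where 'm = 'm] by (auto intro!: exI[of _ "\<lambda>k. 0"])
  have bdd: "bdd_above ?B"
  proof (rule bdd_aboveI)
    fix b assume "b \<in> ?B"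
    then obtain x where x: "x \<in> lp_space p" "lp_norm p x \<le> 1" "b = lp_norm p (S x)"
      by blast
    have "C * lp_norm p x \<le> \<bar>C\<bar> * 1"
      using x lp_norm_nonneg[OF p x(1)] by (intro mult_mono) auto
    then show "b \<le> \<bar>C\<bar>"
      using C[OF x(1)] x(3) by simp
  qed
  show "lp_norm p (S x) \<le> lp_operator_norm p S * lp_norm p x" if x: "x \<in> lp_space p"
  proof (cases "lp_norm p x = 0")
    case True
    then show ?thesis
      using C[OF x] by simp
  next
    case False
    define c where "c = inverse (lp_norm p x)"
    have c: "c > 0"
      using False lp_norm_nonneg[OF p x] by (simp add: c_def)
    have "lp_norm p (\<lambda>k. c *\<^sub>R x k) \<le> 1"
      using lp_scaleR(2)[OF p x, of c] c False by (simp add: c_def)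
    then have "lp_norm p (S (\<lambda>k. c *\<^sub>R x k)) \<in> ?B"
      using lp_scaleR(1)[OF p x] by blast
    then have "lp_norm p (S (\<lambda>k. c *\<^sub>R x k)) \<le> lp_operator_norm p S"
      unfolding lp_operator_norm_def by (rule cSup_upper[OF _ bdd])
    then have "c * lp_norm p (S x) \<le> lp_operator_norm p S"
      using lp_bounded_operator_props(3)[OF S x]
        lp_norm_scaleR[OF p lp_bounded_operator_props(1)[OF S x], of c] c by simp
    then show ?thesis
      using False lp_norm_nonneg[OF p x] by (simp add: c_def field_simps)
  qed
  show "\<exists>z\<in>lp_space p. lp_norm p z \<le> 1 \<and> \<theta> < lp_norm p (S z)" if "\<theta> < lp_operator_norm p S"
    using that less_cSupD[OF ne] unfolding lp_operator_norm_def by blast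
qed

text \<open>The gliding hump proof of the uniform boundedness principle. Of the two points \<open>X n \<plusminus> \<zeta> n\<close>, at least one has
an image under \<open>S n\<close> that is as large as that of \<open>\<zeta> n\<close>, where \<open>\<zeta> n\<close> has norm at most \<open>3\<^sup>-\<^sup>n\<close> and nearly
realises the operator norm \<open>\<tau> n\<close>, up to the factor \<open>2/3\<close>. All later steps together move the point by at
most \<open>3\<^sup>-\<^sup>n / 2\<close>, so \<open>2/3 - 1/2 = 1/6\<close> of \<open>3\<^sup>-\<^sup>n \<tau> n\<close> survives in the limit.\<close>
lemma condensation_of_singularities:
  fixes S :: "nat \<Rightarrow> (nat \<Rightarrow> complex^'m) \<Rightarrow> nat \<Rightarrow> complex^'m"
  assumes S: "\<And>n. lp_bounded_operator p (S n)" and large: "\<And>n. lp_operator_norm p (S n) > 4 ^ n"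
  shows "\<exists>x\<in>lp_space p. \<forall>n. lp_norm p (S n x) \<ge> (4 / 3) ^ n / 6"
proof -
  define \<tau> where "\<tau> n = lp_operator_norm p (S n)" for n
  have \<tau>: "\<tau> n > 4 ^ n" "\<tau> n > 0" for n
    using large[of n] less_trans[of 0 "4 ^ n" "\<tau> n"] by (auto simp: \<tau>_def)
  have "\<exists>z\<in>lp_space p. lp_norm p z \<le> 1 \<and> 2 / 3 * \<tau> n < lp_norm p (S n z)" for n
    using \<tau>(2)[of n] by (intro lp_operator_norm_props(2)[OF S]) (simp add: \<tau>_def)
  then obtain z where z: "\<And>n. z n \<in> lp_space p" "\<And>n. lp_norm p (z n) \<le> 1"
      "\<And>n. 2 / 3 * \<tau> n < lp_norm p (S n (z n))"
    by metis
  define \<zeta> where "\<zeta> n = (\<lambda>k. (1 / 3) ^ n *\<^sub>R z n k)" for n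
  have \<zeta>: "\<zeta> n \<in> lp_space p" "lp_norm p (\<zeta> n) \<le> (1 / 3) ^ n"
      "2 / 3 * \<tau> n * (1 / 3) ^ n \<le> lp_norm p (S n (\<zeta> n))" for n
  proof -
    show "\<zeta> n \<in> lp_space p"
      unfolding \<zeta>_def by (intro lp_scaleR p z)
    show "lp_norm p (\<zeta> n) \<le> (1 / 3) ^ n"
      using lp_norm_scaleR[OF p z(1)[of n], of "(1 / 3) ^ n"] z(2)[of n]
      by (simp add: \<zeta>_def mult_left_le)
    have "lp_norm p (S n (\<zeta> n)) = (1 / 3) ^ n * lp_norm p (S n (z n))"
      unfolding \<zeta>_def lp_bounded_operator_props(3)[OF S z(1)]
      using lp_norm_scaleR[OF p lp_bounded_operator_props(1)[OF S z(1)], of "(1 / 3) ^ n" n n] by simp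
    then show "2 / 3 * \<tau> n * (1 / 3) ^ n \<le> lp_norm p (S n (\<zeta> n))"
      using mult_left_mono[OF less_imp_le[OF z(3)[of n]], of "(1 / 3) ^ n"] by (simp add: mult_ac)
  qed
  define X where "X = rec_nat (\<lambda>k. 0) (\<lambda>n x.
     if lp_norm p (S n (\<zeta> n)) \<le> lp_norm p (S n (\<lambda>k. x k + \<zeta> n k)) then (\<lambda>k. x k + \<zeta> n k) else (\<lambda>k. x k - \<zeta> n k))"
  have X0: "X 0 = (\<lambda>k. 0)"
    and XSuc: "X (Suc n) = (if lp_norm p (S n (\<zeta> n)) \<le> lp_norm p (S n (\<lambda>k. X n k + \<zeta> n k))
      then (\<lambda>k. X n k + \<zeta> n k) else (\<lambda>k. X n k - \<zeta> n k))" for n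
    by (simp_all add: X_def)
  have X: "X n \<in> lp_space p" for n
  proof (induction n)
    case (Suc n)
    then show ?case
      using lp_add(1)[OF p Suc \<zeta>(1)] lp_diff(1)[OF p Suc \<zeta>(1)] by (simp add: XSuc)
  qed (simp add: X0 lp_zero[OF p])
  have step: "lp_norm p (\<lambda>k. X (Suc n) k - X n k) \<le> (1 / 3) ^ n" for n
    using \<zeta>(2)[of n] lp_norm_scaleR[OF p \<zeta>(1), of "- 1" n] by (simp add: XSuc)
  have big: "2 / 3 * \<tau> n * (1 / 3) ^ n \<le> lp_norm p (S n (X (Suc n)))" for n
  proof (cases "lp_norm p (S n (\<zeta> n)) \<le> lp_norm p (S n (\<lambda>k. X n k + \<zeta> n k))")
    case True
    then show ?thesis
      using \<zeta>(3)[of n] by (simp add: XSuc)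
  next
    case False
    let ?u = "S n (\<lambda>k. X n k + \<zeta> n k)" and ?v = "S n (\<lambda>k. X n k - \<zeta> n k)"
    have uv: "?u \<in> lp_space p" "?v \<in> lp_space p"
      using lp_bounded_operator_props(1)[OF S] lp_add(1)[OF p X \<zeta>(1)] lp_diff(1)[OF p X \<zeta>(1)] by auto
    have "(\<lambda>k. ?u k - ?v k) = (\<lambda>k. 2 *\<^sub>R S n (\<zeta> n) k)"
      using lp_bounded_operator_props(2,4)[OF S X \<zeta>(1)] by (simp add: scaleR_2)
    then have "2 * lp_norm p (S n (\<zeta> n)) \<le> lp_norm p ?u + lp_norm p ?v"
      using lp_diff(2)[OF p uv] lp_norm_scaleR[OF p lp_bounded_operator_props(1)[OF S \<zeta>(1)], of 2] by simp
    then show ?thesis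
      using False \<zeta>(3)[of n] by (simp add: XSuc)
  qed
  have tail: "lp_norm p (\<lambda>k. X (Suc n + m) k - X (Suc n) k) \<le> (1 / 2) * ((1 / 3) ^ n - (1 / 3) ^ (n + m))" for n m
  proof (induction m)
    case (Suc m)
    have "lp_norm p (\<lambda>k. (X (Suc n + m) k - X (Suc n) k) + (X (Suc (Suc n + m)) k - X (Suc n + m) k))
        \<le> lp_norm p (\<lambda>k. X (Suc n + m) k - X (Suc n) k) + lp_norm p (\<lambda>k. X (Suc (Suc n + m)) k - X (Suc n + m) k)"
      by (intro lp_add(2) lp_diff(1) p X)
    also have "\<dots> \<le> (1 / 2) * ((1 / 3) ^ n - (1 / 3) ^ (n + m)) + (1 / 3) ^ (Suc n + m)"
      by (intro add_mono Suc step)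
    finally show ?case
      by (simp add: algebra_simps)
  qed (simp add: lp_zero[OF p])
  define x where "x = (\<lambda>k. \<Sum>n. X (Suc n) k - X n k)"
  have "summable (\<lambda>n. X (Suc n) k - X n k)" for k
  proof (rule summable_comparison_test'[of "\<lambda>n. (1 / 3) ^ n" 0])
    show "norm (X (Suc n) k - X n k) \<le> (1 / 3) ^ n" for n
      using lp_component[OF p lp_diff(1)[OF p X X], of "Suc n" k n] step[of n] by linarith
  qed (simp add: summable_geometric)
  then have "(\<lambda>n. \<Sum>i<n. X (Suc i) k - X i k) \<longlonglongrightarrow> x k" for k
    unfolding x_def by (rule summable_LIMSEQ)
  then have lim: "(\<lambda>n. X n k) \<longlonglongrightarrow> x k" for k
    using sum_lessThan_telescope[of "\<lambda>n. X n k" for k] by (simp add: X0)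
  have x: "(\<lambda>k. x k - X (Suc n) k) \<in> lp_space p" "lp_norm p (\<lambda>k. x k - X (Suc n) k) \<le> (1 / 2) * (1 / 3) ^ n" for n
  proof -
    have mem: "(\<lambda>k. X (Suc n + m) k - X (Suc n) k) \<in> lp_space p" for m
      by (intro lp_diff p X)
    have le: "lp_norm p (\<lambda>k. X (Suc n + m) k - X (Suc n) k) \<le> (1 / 2) * (1 / 3) ^ n" for m
      by (rule order_trans[OF tail]) simp
    have "(\<lambda>m. X (Suc n + m) k - X (Suc n) k) \<longlonglongrightarrow> x k - X (Suc n) k" for k
      using LIMSEQ_ignore_initial_segment[OF lim, of "Suc n" k] by (intro tendsto_intros) (simp add: add.commute)
    from lp_limit[OF p mem le this]
    show "(\<lambda>k. x k - X (Suc n) k) \<in> lp_space p" "lp_norm p (\<lambda>k. x k - X (Suc n) k) \<le> (1 / 2) * (1 / 3) ^ n"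
      by auto
  qed
  have x_mem: "x \<in> lp_space p"
    using lp_add(1)[OF p x(1)[of 0] X[of "Suc 0"]] by simp
  have "lp_norm p (S n x) \<ge> (4 / 3) ^ n / 6" for n
  proof -
    let ?d = "\<lambda>k. x k - X (Suc n) k"
    have Sx: "S n (X (Suc n)) = (\<lambda>k. S n x k - S n ?d k)"
      using lp_bounded_operator_props(4)[OF S x_mem x(1), of n n] by simp
    have "2 / 3 * \<tau> n * (1 / 3) ^ n \<le> lp_norm p (S n x) + lp_norm p (S n ?d)"
      using big[of n] lp_diff(2)[OF p lp_bounded_operator_props(1)[OF S x_mem] lp_bounded_operator_props(1)[OF S x(1)], of n n n]
      unfolding Sx by linarith
    also have "lp_norm p (S n ?d) \<le> \<tau> n * ((1 / 2) * (1 / 3) ^ n)"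
      using lp_operator_norm_props(1)[OF S x(1), of n n] mult_left_mono[OF x(2)[of n] less_imp_le[OF \<tau>(2)[of n]]]
      by (simp add: \<tau>_def)
    finally have "\<tau> n * (1 / 3) ^ n / 6 \<le> lp_norm p (S n x)"
      by simp
    moreover have "(4 / 3) ^ n \<le> \<tau> n * (1 / 3 :: real) ^ n"
      using mult_right_mono[OF less_imp_le[OF \<tau>(1)[of n]], of "(1 / 3) ^ n"] by (simp flip: power_mult_distrib)
    ultimately show ?thesis
      by linarith
  qed
  then show ?thesis
    using x_mem by blast
qed

text \<open>If the norms were unbounded near \<open>0\<close>, condensation of singularities along a sequence of times tending to
\<open>0\<close> would contradict strong continuity at \<open>0\<close>. The semigroup law propagates the bound to \<open>{0..t}\<close>.\<close>
lemma semigroup_locally_bounded: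
  fixes T :: "real \<Rightarrow> (nat \<Rightarrow> complex^'m) \<Rightarrow> nat \<Rightarrow> complex^'m"
  assumes T: "lp_C0_semigroup p T"
  obtains M where "M \<ge> 0" "\<And>s x. 0 \<le> s \<Longrightarrow> s \<le> t \<Longrightarrow> x \<in> lp_space p \<Longrightarrow> lp_norm p (T s x) \<le> M * lp_norm p x"
proof -
  have bdd: "lp_bounded_operator p (T s)" if "s \<ge> 0" for s
    using T that by (simp add: lp_C0_semigroup_def)
  have T0: "T 0 x = x" if "x \<in> lp_space p" for x
    using T that by (simp add: lp_C0_semigroup_def)
  have cont: "((\<lambda>s. lp_norm p (\<lambda>k. T s x k - x k)) \<longlongrightarrow> 0) (at_right 0)" if "x \<in> lp_space p" for x
    using T that by (simp add: lp_C0_semigroup_def)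
  have "\<exists>\<delta>>0. \<exists>M\<ge>1. \<forall>s x. 0 \<le> s \<and> s \<le> \<delta> \<and> x \<in> lp_space p \<longrightarrow> lp_norm p (T s x) \<le> M * lp_norm p x"
  proof (rule ccontr)
    assume contr: "\<not> ?thesis"
    have "\<exists>s x. 0 \<le> s \<and> s \<le> 1 / Suc n \<and> x \<in> lp_space p \<and> lp_norm p (T s x) > 4 ^ n * lp_norm p x" for n
    proof -
      have "0 < 1 / real (Suc n)" "1 \<le> (4::real) ^ n"
        by auto
      then show ?thesis
        using contr by (meson not_le)
    qed
    then obtain s y where s: "\<And>n. 0 \<le> s n" "\<And>n. s n \<le> 1 / Suc n"
      and y: "\<And>n. y n \<in> lp_space p" "\<And>n. lp_norm p (T (s n) (y n)) > 4 ^ n * lp_norm p (y n)"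
      by metis
    have "lp_operator_norm p (T (s n)) > 4 ^ n" for n
    proof -
      have "4 ^ n * lp_norm p (y n) < lp_operator_norm p (T (s n)) * lp_norm p (y n)"
        using y(2)[of n] lp_operator_norm_props(1)[OF bdd[OF s(1)] y(1), of n n] by linarith
      then show ?thesis
        using lp_norm_nonneg[OF p y(1)] by (simp add: mult_less_cancel_right)
    qed
    then obtain x where x: "x \<in> lp_space p" "\<And>n. lp_norm p (T (s n) x) \<ge> (4 / 3) ^ n / 6"
      using condensation_of_singularities[of "\<lambda>n. T (s n)"] bdd s(1) by blast
    have "\<forall>\<^sub>F h in at_right 0. lp_norm p (\<lambda>k. T h x k - x k) < 1"
      using order_tendstoD(2)[OF cont[OF x(1)]] by simp
    then obtain d where d: "d > 0" "\<And>h. 0 < h \<Longrightarrow> h < d \<Longrightarrow> lp_norm p (\<lambda>k. T h x k - x k) < 1"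
      by (auto simp: eventually_at_right_field)
    have small: "lp_norm p (T h x) \<le> lp_norm p x + 1" if h: "0 \<le> h" "h < d" for h
    proof (cases "h = 0")
      case False
      then have "lp_norm p (\<lambda>k. T h x k - x k) < 1"
        using d h by simp
      moreover have "lp_norm p (\<lambda>k. (T h x k - x k) + x k) \<le> lp_norm p (\<lambda>k. T h x k - x k) + lp_norm p x"
        using lp_bounded_operator_props(1)[OF bdd[OF h(1)] x(1)] by (intro lp_add(2) lp_diff(1) p x(1))
      ultimately show ?thesis
        by simp
    qed (simp add: T0 x)
    have "\<forall>\<^sub>F n in sequentially. 1 / real (Suc n) < d"
      using order_tendstoD(2)[OF LIMSEQ_inverse_real_of_nat d(1)] by (simp add: inverse_eq_divide)
    moreover have "\<forall>\<^sub>F n in sequentially. (4 / 3) ^ n / 6 > lp_norm p x + 1"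
    proof -
      have "filterlim (\<lambda>n. (4 / 3 :: real) ^ n / 6) at_top sequentially"
        by real_asymp
      then show ?thesis
        unfolding filterlim_at_top_dense by blast
    qed
    ultimately have "\<forall>\<^sub>F n in sequentially. False"
    proof eventually_elim
      case (elim n)
      then show ?case
        using small[OF s(1)[of n]] s(2)[of n] x(2)[of n] by linarith
    qed
    then show False
      by simp
  qed
  then obtain \<delta> M where \<delta>: "\<delta> > 0" and M: "M \<ge> 1"
    and small: "\<And>s x. 0 \<le> s \<Longrightarrow> s \<le> \<delta> \<Longrightarrow> x \<in> lp_space p \<Longrightarrow> lp_norm p (T s x) \<le> M * lp_norm p x"
    by blast
  have grow: "lp_norm p (T s x) \<le> M ^ n * lp_norm p x" if "0 \<le> s" "s \<le> n * \<delta>" "x \<in> lp_space p" for n :: nat and s x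
    using that
  proof (induction n arbitrary: s x)
    case 0
    then show ?case by (simp add: T0)
  next
    case (Suc n)
    show ?case
    proof (cases "s \<le> \<delta>")
      case True
      have "M * 1 \<le> M * M ^ n"
        using M by (intro mult_left_mono) auto
      then have "M * lp_norm p x \<le> M ^ Suc n * lp_norm p x"
        using lp_norm_nonneg[OF p Suc.prems(3)] by (intro mult_right_mono) auto
      then show ?thesis
        using small[OF Suc.prems(1) True Suc.prems(3)] by linarith
    next
      case False
      have mem: "T \<delta> x \<in> lp_space p"
        using lp_bounded_operator_props(1)[OF bdd Suc.prems(3)] \<delta> by simp
      have "T (s - \<delta> + \<delta>) x = T (s - \<delta>) (T \<delta> x)"
        using T False \<delta> Suc.prems(3) unfolding lp_C0_semigroup_def by (meson diff_ge_0_iff_ge less_imp_le not_le)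
      then have "lp_norm p (T s x) = lp_norm p (T (s - \<delta>) (T \<delta> x))"
        by simp
      also have "\<dots> \<le> M ^ n * lp_norm p (T \<delta> x)"
        using Suc.prems(2) False by (intro Suc.IH mem) (auto simp: algebra_simps)
      also have "\<dots> \<le> M ^ n * (M * lp_norm p x)"
        using small[OF _ _ Suc.prems(3), of \<delta>] \<delta> M by (intro mult_left_mono) auto
      finally show ?thesis
        by (simp add: mult_ac)
    qed
  qed
  obtain n :: nat where "t \<le> n * \<delta>"
    using ex_less_of_nat_mult[OF \<delta>, of t] less_imp_le by blast
  then show ?thesis
    using that[of "M ^ n"] grow M by (meson dual_order.trans zero_le_power zero_le_one)
qed

text \<open>The generator only controls quotients from the right. Writing \<open>m = min s t\<close> and \<open>h = \<bar>s - t\<bar>\<close>, the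
quotient at \<open>s, t\<close> equals \<open>T(m)\<close> applied to the quotient of \<open>x\<close> at \<open>h\<close>, from either side, and local
boundedness makes the convergence uniform in \<open>m\<close>.\<close>
lemma semigroup_component_derivative:
  fixes T :: "real \<Rightarrow> (nat \<Rightarrow> complex^'m) \<Rightarrow> nat \<Rightarrow> complex^'m"
  assumes gen: "lp_semigroup_generated_by p A T" and x: "x \<in> lp_space p" and t: "t \<ge> 0"
  shows "((\<lambda>s. T s x k) has_vector_derivative A (T t x) k) (at t within {0..})"
proof -
  have T: "lp_C0_semigroup p T" and graph: "lp_generator p T = {(x, A x) | x. x \<in> lp_space p}"
    using gen by (auto simp: lp_semigroup_generated_by_def)
  have bdd: "lp_bounded_operator p (T s)" if "s \<ge> 0" for s
    using T that by (simp add: lp_C0_semigroup_def)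
  have cont: "((\<lambda>s. lp_norm p (\<lambda>k. T s y k - y k)) \<longlongrightarrow> 0) (at_right 0)" if "y \<in> lp_space p" for y
    using T that by (simp add: lp_C0_semigroup_def)
  have T0: "T 0 y = y" if "y \<in> lp_space p" for y
    using T that by (simp add: lp_C0_semigroup_def)
  have Tadd: "T (r + s) y = T r (T s y)" if "r \<ge> 0" "s \<ge> 0" "y \<in> lp_space p" for r s y
    using T that by (simp add: lp_C0_semigroup_def)
  have Tmem: "T s y \<in> lp_space p" if "s \<ge> 0" "y \<in> lp_space p" for s y
    using lp_bounded_operator_props(1)[OF bdd] that by blast
  have A: "A y \<in> lp_space p" "((\<lambda>h. lp_norm p (\<lambda>k. (T h y k - y k) /\<^sub>R h - A y k)) \<longlongrightarrow> 0) (at_right 0)"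
    if "y \<in> lp_space p" for y
  proof -
    have "(y, A y) \<in> lp_generator p T"
      using that graph by blast
    then show "A y \<in> lp_space p" "((\<lambda>h. lp_norm p (\<lambda>k. (T h y k - y k) /\<^sub>R h - A y k)) \<longlongrightarrow> 0) (at_right 0)"
      by (auto simp: lp_generator_def)
  qed
  obtain M where M: "M \<ge> 0"
    "\<And>s y. 0 \<le> s \<Longrightarrow> s \<le> t + 1 \<Longrightarrow> y \<in> lp_space p \<Longrightarrow> lp_norm p (T s y) \<le> M * lp_norm p y"
    using semigroup_locally_bounded[OF T, of "t + 1"] by blast
  define quot where "quot h = (\<lambda>k. (T h x k - x k) /\<^sub>R h - A x k)" for h
  define inc where "inc h = (\<lambda>k. T h (A x) k - A x k)" for h
  have quot_mem: "quot h \<in> lp_space p" and inc_mem: "inc h \<in> lp_space p" if "h \<ge> 0" for h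
    unfolding quot_def inc_def using that by (intro lp_diff lp_scaleR p A x Tmem; simp)+
  have near: "\<forall>\<^sub>F s in at t within {0..}. 0 \<le> s \<and> s \<le> t + 1 \<and> s \<noteq> t"
    unfolding eventually_at by (rule exI[of _ 1]) (auto simp: dist_real_def)
  have dist_lim: "filterlim (\<lambda>s. \<bar>s - t\<bar>) (at_right 0) (at t within {0..})"
  proof -
    have "((\<lambda>s. \<bar>s - t\<bar>) \<longlongrightarrow> \<bar>t - t\<bar>) (at t within {0..})"
      by (intro tendsto_intros)
    then show ?thesis
      unfolding filterlim_at using near by (auto elim: eventually_mono)
  qed
  have bound: "\<forall>\<^sub>F s in at t within {0..}. norm ((T s x k - T t x k) /\<^sub>R (s - t) - T t (A x) k)
      \<le> M * lp_norm p (quot \<bar>s - t\<bar>) + M * lp_norm p (inc \<bar>s - t\<bar>)"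
    using near
  proof eventually_elim
    case (elim s)
    define h m where "h = \<bar>s - t\<bar>" and "m = min s t"
    have h: "h > 0" and m: "0 \<le> m" "m \<le> t + 1"
      using elim t by (auto simp: h_def m_def)
    have "(T s x k - T t x k) /\<^sub>R (s - t) = (T (m + h) x k - T m x k) /\<^sub>R h"
    proof (cases "s < t")
      case True
      then have "m = s" "h = t - s" "m + h = t"
        by (auto simp: m_def h_def)
      then show ?thesis
        by (metis (no_types) inverse_minus_eq minus_diff_eq scaleR_minus_left scaleR_minus_right)
    qed (use elim in \<open>simp add: h_def m_def\<close>)
    also have "\<dots> = T m (\<lambda>k. (T h x k - x k) /\<^sub>R h) k"
      using h m x by (simp add: Tadd lp_bounded_operator_props[OF bdd] lp_diff[OF p] Tmem)
    finally have eq: "(T s x k - T t x k) /\<^sub>R (s - t) = T m (\<lambda>k. (T h x k - x k) /\<^sub>R h) k" .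
    have q: "T m (quot h) k = T m (\<lambda>k. (T h x k - x k) /\<^sub>R h) k - T m (A x) k"
      unfolding quot_def using h m x
      by (subst lp_bounded_operator_props(4)[OF bdd]) (auto intro!: lp_scaleR lp_diff p Tmem A)
    have quot_le: "norm (T m (quot h) k) \<le> M * lp_norm p (quot h)"
      using lp_component[OF p Tmem[OF m(1) quot_mem], of h k] M(2)[OF m quot_mem, of h] h by simp
    have inc_le: "norm (T t (A x) k - T m (A x) k) \<le> M * lp_norm p (inc h)"
    proof (cases "s < t")
      case True
      then have "t = m + h"
        by (auto simp: m_def h_def)
      then have "T t (A x) k - T m (A x) k = T m (inc h) k"
        unfolding inc_def using h m x
        by (subst lp_bounded_operator_props(4)[OF bdd]) (auto simp: Tadd A Tmem)
      then show ?thesis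
        using lp_component[OF p Tmem[OF m(1) inc_mem], of h k] M(2)[OF m inc_mem, of h] h by simp
    next
      case False
      then have "m = t"
        by (simp add: m_def)
      then show ?thesis
        using M(1) lp_norm_nonneg[OF p inc_mem] h by simp
    qed
    have split: "(T s x k - T t x k) /\<^sub>R (s - t) - T t (A x) k = T m (quot h) k - (T t (A x) k - T m (A x) k)"
      unfolding eq q by simp
    show ?case
      unfolding split h_def[symmetric]
      by (rule order_trans[OF norm_triangle_ineq4 add_mono[OF quot_le inc_le]])
  qed
  have "((\<lambda>h. M * lp_norm p (quot h) + M * lp_norm p (inc h)) \<longlongrightarrow> M * 0 + M * 0) (at_right 0)"
    unfolding quot_def inc_def by (intro tendsto_intros A x cont)
  from filterlim_compose[OF this dist_lim]
  have "((\<lambda>s. (T s x k - T t x k) /\<^sub>R (s - t) - T t (A x) k) \<longlongrightarrow> 0) (at t within {0..})"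
    by (intro Lim_null_comparison[OF bound]) simp
  then have deriv: "((\<lambda>s. (T s x k - T t x k) /\<^sub>R (s - t)) \<longlongrightarrow> T t (A x) k) (at t within {0..})"
    by (simp add: LIM_zero_iff)
  \<comment> \<open>The semigroup commutes with its generator: both sides are right derivatives at \<open>t\<close>.\<close>
  have commute: "T t (A x) k = A (T t x) k"
  proof (rule tendsto_unique[of "at_right (0::real)"])
    have "filterlim (\<lambda>h. t + h) (at t within {0..}) (at_right 0)"
    proof -
      have "((\<lambda>h. t + h) \<longlongrightarrow> t + 0) (at_right 0)"
        by (intro tendsto_intros)
      then show ?thesis
        unfolding filterlim_at using t by (auto simp: eventually_at_filter)
    qed
    from filterlim_compose[OF deriv this]
    show "((\<lambda>h. (T (t + h) x k - T t x k) /\<^sub>R h) \<longlongrightarrow> T t (A x) k) (at_right 0)"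
      by simp
    have "\<forall>\<^sub>F h in at_right 0. norm ((T (t + h) x k - T t x k) /\<^sub>R h - A (T t x) k)
        \<le> lp_norm p (\<lambda>k. (T h (T t x) k - T t x k) /\<^sub>R h - A (T t x) k)"
      using eventually_at_right_less[of 0]
    proof eventually_elim
      case (elim h)
      have "(\<lambda>k. (T h (T t x) k - T t x k) /\<^sub>R h - A (T t x) k) \<in> lp_space p"
        using elim t x by (intro lp_diff lp_scaleR p A Tmem) auto
      from lp_component[OF p this, of k] show ?case
        using Tadd[of h t x] elim t x by (simp add: add.commute)
    qed
    from Lim_null_comparison[OF this A(2)[OF Tmem[OF t x]]]
    show "((\<lambda>h. (T (t + h) x k - T t x k) /\<^sub>R h) \<longlongrightarrow> A (T t x) k) (at_right 0)"
      by (simp add: LIM_zero_iff)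
  qed simp
  show ?thesis
    using has_vector_derivativeI_quotient[OF deriv] by (simp add: commute)
qed

end

section \<open>The scalar cascade\<close>

lemma conv_linear_right:
  assumes "continuous_on {0..} f" "\<And>i. i \<in> I \<Longrightarrow> continuous_on {0..} (g i)" "finite I" "t \<ge> 0"
  shows "conv f (\<lambda>s. \<Sum>i\<in>I. c i * g i s) t = (\<Sum>i\<in>I. c i * conv f (g i) t)"
proof -
  have "conv f (\<lambda>s. c i * g i s) t = c i * conv f (g i) t" for i
    unfolding conv_def by (simp add: mult.left_commute)
  then show ?thesis
    using assms by (subst conv_sum_right) (auto intro!: continuous_intros)
qed

text \<open>The form in which the integrals of the cascade are estimated: a bound by a combination of the \<open>g j\<close> is
carried to the same combination of the convolutions.\<close>
lemma norm_integral_le_conv: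
  fixes F :: "real \<Rightarrow> 'a::banach"
  assumes F: "(F has_integral I) {0..t}" and t: "t \<ge> 0"
    and f: "continuous_on {0..} f" and g: "\<And>j. continuous_on {0..} (g j)"
    and le: "\<And>s. 0 \<le> s \<Longrightarrow> s \<le> t \<Longrightarrow> norm (F s) \<le> f (t - s) * (\<Sum>j\<le>k. c j * g j s)"
  shows "norm I \<le> (\<Sum>j\<le>(k::nat). c j * conv f (g j) t)"
proof -
  have "norm (integral {0..t} F) \<le> integral {0..t} (\<lambda>s. f (t - s) * (\<Sum>j\<le>k. c j * g j s))"
    using F le t by (intro integral_norm_bound_integral conv_integrable f) (auto intro!: continuous_intros g)
  also have "\<dots> = (\<Sum>j\<le>k. c j * conv f (g j) t)"
    using conv_linear_right[of f "{..k}" g t c] f g t by (simp add: conv_def)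
  finally show ?thesis
    using F by (simp add: integral_unique)
qed

lemma conv_exp_const_le:
  assumes b: "b > 0" and C: "C \<ge> 0" and t: "t \<ge> 0"
  shows "conv (\<lambda>u. exp (- (b * u))) (\<lambda>_. C) t \<le> C / b"
proof -
  have "((\<lambda>s. exp (- (b * (t - s))) * C) has_integral
      (C / b * exp (- (b * (t - t))) - C / b * exp (- (b * (t - 0))))) {0..t}"
  proof (rule fundamental_theorem_of_calculus[OF t])
    show "((\<lambda>s. C / b * exp (- (b * (t - s)))) has_vector_derivative exp (- (b * (t - u))) * C) (at u within {0..t})" for u
      using b by (auto intro!: derivative_eq_intros simp flip: has_real_derivative_iff_has_vector_derivative)
  qed
  then have "conv (\<lambda>u. exp (- (b * u))) (\<lambda>_. C) t = C / b - C / b * exp (- (b * t))"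
    unfolding conv_def by (subst integral_unique) auto
  then show ?thesis
    using b C by simp
qed

text \<open>The integrand is the derivative of \<open>exp((t - s) A\<^sub>0) f(s)\<close>.\<close>
lemma variation_of_constants:
  fixes f w :: "real \<Rightarrow> complex^'m"
  assumes t: "t \<ge> 0"
    and f: "\<And>s. 0 \<le> s \<Longrightarrow> s \<le> t \<Longrightarrow> (f has_vector_derivative (A0 *v f s + w s)) (at s within {0..t})"
  shows "((\<lambda>s. app (exp ((t - s) *\<^sub>R endo_of_matrix A0)) (w s)) has_integral
    (f t - app (exp (t *\<^sub>R endo_of_matrix A0)) (f 0))) {0..t}"
proof -
  let ?A = "endo_of_matrix A0"
  let ?E = "\<lambda>s. exp ((t - s) *\<^sub>R ?A)"
  have "((\<lambda>s. app (?E s) (w s)) has_integral (app (?E t) (f t) - app (?E 0) (f 0))) {0..t}"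
  proof (rule fundamental_theorem_of_calculus[OF t])
    fix s assume s: "s \<in> {0..t}"
    have "((\<lambda>s. t - s) has_vector_derivative - 1) (at s within {0..t})"
      by (auto intro!: derivative_eq_intros)
    from vector_diff_chain_within[OF this exp_scaleR_has_vector_derivative_right[of ?A]]
    have E: "(?E has_vector_derivative - (?E s * ?A)) (at s within {0..t})"
      by (simp add: o_def)
    from app.has_vector_derivative[OF E f[of s]] s
    have "((\<lambda>s. app (?E s) (f s)) has_vector_derivative
        app (?E s) (A0 *v f s + w s) + app (- (?E s * ?A)) (f s)) (at s within {0..t})"
      by simp
    moreover have "app (?E s) (A0 *v f s + w s) + app (- (?E s * ?A)) (f s) = app (?E s) (w s)"
      by (simp add: app.add_right app.minus_left app_mult)
    ultimately show "((\<lambda>s. app (?E s) (f s)) has_vector_derivative app (?E s) (w s)) (at s within {0..t})"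
      by simp
  qed
  then show ?thesis
    by (simp add: app_one)
qed

text \<open>The functions \<open>y k\<close> stand for the components of one orbit of the semigroup.\<close>
locale scalar_cascade =
  fixes A0 A1 :: "complex^'m^'m" and h :: "real \<Rightarrow> real" and b M :: real
    and y :: "nat \<Rightarrow> real \<Rightarrow> complex^'m"
  assumes sandwich: "\<And>u. u \<ge> 0 \<Longrightarrow> endo_of_matrix A1 * exp (u *\<^sub>R endo_of_matrix A0) * endo_of_matrix A1
      = h u *\<^sub>R endo_of_matrix A1"
    and h_cont: "continuous_on {0..} h" and h_nonneg: "\<And>u. u \<ge> 0 \<Longrightarrow> h u \<ge> 0"
    and stable: "\<And>u. u \<ge> 0 \<Longrightarrow> norm (exp (u *\<^sub>R endo_of_matrix A0)) \<le> M * exp (- (b * u))"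
    and b: "b > 0"
    and y_0: "\<And>s. s \<ge> 0 \<Longrightarrow> (y 0 has_vector_derivative A0 *v y 0 s) (at s within {0..})"
    and y_Suc: "\<And>k s. s \<ge> 0 \<Longrightarrow>
      (y (Suc k) has_vector_derivative A0 *v y (Suc k) s + A1 *v y k s) (at s within {0..})"
begin

abbreviation "A \<equiv> endo_of_matrix A0"
abbreviation "B \<equiv> endo_of_matrix A1"
abbreviation "g \<equiv> renewal_term h b"

lemma M_nonneg: "M \<ge> 0"
  using order_trans[OF norm_ge_zero stable[of 0]] by simp

lemma norm_app_exp_le: "u \<ge> 0 \<Longrightarrow> norm (app (exp (u *\<^sub>R A)) v) \<le> M * exp (- (b * u)) * norm v"
  by (rule order_trans[OF norm_app]) (intro mult_right_mono stable norm_ge_zero)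

lemma y_0_eq: "t \<ge> 0 \<Longrightarrow> y 0 t = app (exp (t *\<^sub>R A)) (y 0 0)"
proof -
  assume t: "t \<ge> 0"
  have "((\<lambda>s. app (exp ((t - s) *\<^sub>R A)) 0) has_integral (y 0 t - app (exp (t *\<^sub>R A)) (y 0 0))) {0..t}"
    using y_0 by (intro variation_of_constants[OF t])
      (auto intro: has_vector_derivative_within_subset[where S = "{0..}"])
  then show ?thesis
    by (simp add: app.zero_right)
qed

lemma y_Suc_integral:
  assumes t: "t \<ge> 0"
  shows "((\<lambda>s. app (exp ((t - s) *\<^sub>R A)) (A1 *v y k s)) has_integral
    (y (Suc k) t - app (exp (t *\<^sub>R A)) (y (Suc k) 0))) {0..t}"
  using y_Suc by (intro variation_of_constants[OF t])
    (auto intro: has_vector_derivative_within_subset[where S = "{0..}"])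

text \<open>Applying \<open>A\<^sub>1\<close> to the variation of constants formula turns the operator kernel \<open>A\<^sub>1 exp((t - s) A\<^sub>0) A\<^sub>1\<close> into
the scalar \<open>h(t - s)\<close>, so each level of the cascade costs one convolution with \<open>h\<close>.\<close>
lemma norm_A1_y_le:
  "t \<ge> 0 \<Longrightarrow> norm (A1 *v y k t) \<le> (\<Sum>j\<le>k. norm B * M * norm (y j 0) * g (k - j) t)"
proof (induction k arbitrary: t)
  case 0
  have "norm (app B (y 0 t)) \<le> norm B * (M * exp (- (b * t)) * norm (y 0 0))"
    unfolding y_0_eq[OF 0] by (rule order_trans[OF norm_app]) (intro mult_left_mono norm_app_exp_le 0 norm_ge_zero)
  then show ?case
    by (simp add: mult_ac)
next
  case (Suc k)
  let ?c = "\<lambda>j. norm B * M * norm (y j 0)"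
  have int: "((\<lambda>s. app B (app (exp ((t - s) *\<^sub>R A)) (A1 *v y k s))) has_integral
      app B (y (Suc k) t - app (exp (t *\<^sub>R A)) (y (Suc k) 0))) {0..t}"
    using has_integral_linear[OF y_Suc_integral[OF Suc.prems] app.bounded_linear_right[of B]]
    by (simp add: o_def)
  have eq: "app B (app (exp ((t - s) *\<^sub>R A)) (A1 *v y k s)) = h (t - s) *\<^sub>R (A1 *v y k s)"
    if "s \<le> t" for s
  proof -
    have "app B (app (exp ((t - s) *\<^sub>R A)) (app B (y k s))) = app (h (t - s) *\<^sub>R B) (y k s)"
      using that by (simp only: app_mult flip: sandwich)
    then show ?thesis
      by (simp add: app.scaleR_left)
  qed
  have integral_le: "norm (app B (y (Suc k) t - app (exp (t *\<^sub>R A)) (y (Suc k) 0)))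
      \<le> (\<Sum>j\<le>k. ?c j * conv h (g (k - j)) t)"
  proof (rule norm_integral_le_conv[OF int Suc.prems h_cont continuous_on_renewal_term[OF h_cont]])
    show "norm (app B (app (exp ((t - s) *\<^sub>R A)) (A1 *v y k s))) \<le> h (t - s) * (\<Sum>j\<le>k. ?c j * g (k - j) s)"
      if "0 \<le> s" "s \<le> t" for s
      unfolding eq[OF that(2)] using Suc.IH[OF that(1)] h_nonneg[of "t - s"] that
      by (simp add: mult_left_mono)
  qed
  have initial_le: "norm (app B (app (exp (t *\<^sub>R A)) (y (Suc k) 0))) \<le> ?c (Suc k) * g 0 t"
  proof -
    have "norm (app B (app (exp (t *\<^sub>R A)) (y (Suc k) 0))) \<le> norm B * (M * exp (- (b * t)) * norm (y (Suc k) 0))"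
      by (rule order_trans[OF norm_app]) (intro mult_left_mono norm_app_exp_le Suc.prems norm_ge_zero)
    then show ?thesis
      by (simp add: mult_ac)
  qed
  have split: "app B (y (Suc k) t) = app B (y (Suc k) t - app (exp (t *\<^sub>R A)) (y (Suc k) 0))
      + app B (app (exp (t *\<^sub>R A)) (y (Suc k) 0))"
    unfolding app.diff_right by simp
  have "norm (app B (y (Suc k) t)) \<le> (\<Sum>j\<le>k. ?c j * conv h (g (k - j)) t) + ?c (Suc k) * g 0 t"
    by (subst split) (rule order_trans[OF norm_triangle_ineq add_mono[OF integral_le initial_le]])
  also have "(\<Sum>j\<le>k. ?c j * conv h (g (k - j)) t) = (\<Sum>j\<le>k. ?c j * g (Suc k - j) t)"
    by (intro sum.cong) (auto simp: Suc_diff_le)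
  finally show ?case
    by simp
qed

text \<open>A bound for the influence at time \<open>t\<close> of an initial entry on the entry \<open>n\<close> places further on; the last
convolution is the step from \<open>A\<^sub>1 y\<close> back to \<open>y\<close>.\<close>
definition gain :: "real \<Rightarrow> nat \<Rightarrow> real" where
  "gain t n = (case n of 0 \<Rightarrow> M | Suc m \<Rightarrow> M * (norm B * M) * conv (\<lambda>u. exp (- (b * u))) (g m) t)"

lemma norm_y_le:
  assumes t: "t \<ge> 0"
  shows "norm (y k t) \<le> (\<Sum>j\<le>k. gain t (k - j) * norm (y j 0))"
proof -
  have initial: "norm (app (exp (t *\<^sub>R A)) v) \<le> M * norm v" for v
  proof -
    have "M * exp (- (b * t)) * norm v \<le> M * 1 * norm v"
      using b t M_nonneg by (intro mult_right_mono mult_left_mono) auto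
    then show ?thesis
      using norm_app_exp_le[OF t, of v] by simp
  qed
  show ?thesis
  proof (cases k)
    case 0
    then show ?thesis
      using initial[of "y 0 0"] y_0_eq[OF t] by (simp add: gain_def)
  next
    case (Suc k')
    let ?e = "\<lambda>u. exp (- (b * u))" and ?c = "\<lambda>j. M * (norm B * M) * norm (y j 0)"
    have "norm (y (Suc k') t - app (exp (t *\<^sub>R A)) (y (Suc k') 0)) \<le> (\<Sum>j\<le>k'. ?c j * conv ?e (g (k' - j)) t)"
    proof (rule norm_integral_le_conv[OF y_Suc_integral[OF t] t _ continuous_on_renewal_term[OF h_cont]])
      show "continuous_on {0..} ?e"
        by (intro continuous_intros)
      fix s assume s: "0 \<le> s" "s \<le> t"
      have "norm (app (exp ((t - s) *\<^sub>R A)) (A1 *v y k' s)) \<le> M * ?e (t - s) * norm (A1 *v y k' s)"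
        using s by (intro norm_app_exp_le) simp
      also have "\<dots> \<le> M * ?e (t - s) * (\<Sum>j\<le>k'. norm B * M * norm (y j 0) * g (k' - j) s)"
        using M_nonneg by (intro mult_left_mono norm_A1_y_le s) auto
      also have "\<dots> = ?e (t - s) * (\<Sum>j\<le>k'. ?c j * g (k' - j) s)"
        by (simp add: sum_distrib_left mult_ac)
      finally show "norm (app (exp ((t - s) *\<^sub>R A)) (A1 *v y k' s)) \<le> ?e (t - s) * (\<Sum>j\<le>k'. ?c j * g (k' - j) s)" .
    qed
    also have "\<dots> = (\<Sum>j\<le>k'. gain t (Suc k' - j) * norm (y j 0))"
      by (intro sum.cong) (auto simp: gain_def Suc_diff_le)
    finally have "norm (y (Suc k') t) \<le> (\<Sum>j\<le>k'. gain t (Suc k' - j) * norm (y j 0)) + M * norm (y (Suc k') 0)"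
      using initial[of "y (Suc k') 0"] norm_triangle_sub[of "y (Suc k') t" "app (exp (t *\<^sub>R A)) (y (Suc k') 0)"]
      by linarith
    then show ?thesis
      unfolding Suc by (simp add: gain_def)
  qed
qed

lemma gain_nonneg: "t \<ge> 0 \<Longrightarrow> gain t n \<ge> 0"
proof (cases n)
  case (Suc m)
  assume t: "t \<ge> 0"
  have "conv (\<lambda>u. exp (- (b * u))) (\<lambda>_. 0) t \<le> conv (\<lambda>u. exp (- (b * u))) (g m) t"
    by (intro conv_mono t continuous_on_renewal_term h_cont renewal_term_nonneg h_nonneg)
      (auto intro!: continuous_intros)
  then show ?thesis
    using Suc M_nonneg by (simp add: gain_def conv_def)
qed (simp add: gain_def M_nonneg)

lemma sum_gain_le:
  assumes t: "t \<ge> 0" and C: "C \<ge> 0" "\<And>s N. s \<ge> 0 \<Longrightarrow> (\<Sum>n<N. g n s) \<le> C"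
  shows "(\<Sum>n<N. gain t n) \<le> M + M * (norm B * M) * (C / b)"
proof (cases N)
  case (Suc N')
  let ?e = "\<lambda>u. exp (- (b * u))"
  have e: "continuous_on {0..} ?e"
    by (intro continuous_intros)
  have "(\<Sum>n<N'. conv ?e (g n) t) = conv ?e (\<lambda>s. \<Sum>n<N'. g n s) t"
    by (intro conv_sum_right[symmetric] e continuous_on_renewal_term h_cont t) auto
  also have "\<dots> \<le> conv ?e (\<lambda>_. C) t"
    by (intro conv_mono e t C continuous_on_sum continuous_on_renewal_term h_cont) auto
  also have "\<dots> \<le> C / b"
    by (rule conv_exp_const_le[OF b C(1) t])
  finally have "M * (norm B * M) * (\<Sum>n<N'. conv ?e (g n) t) \<le> M * (norm B * M) * (C / b)"
    using M_nonneg by (intro mult_left_mono) auto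
  then show ?thesis
    unfolding Suc by (simp add: sum.lessThan_Suc_shift gain_def sum_distrib_left del: sum.lessThan_Suc)
qed (use M_nonneg b C in simp)

end

section \<open>Boundedness of the semigroup\<close>
theorem theorem2p7:
  fixes p :: ennreal
    and A0 A1 :: "complex^'m^'m"
    and \<phi> :: "complex \<Rightarrow> complex"
    and T :: "real \<Rightarrow> (nat \<Rightarrow> complex^'m) \<Rightarrow> (nat \<Rightarrow> complex^'m)"
  assumes "1 \<le> p"
    and "A1 \<noteq> 0"
    and "characteristic_function A0 A1 \<phi>"
    and "lp_semigroup_generated_by p (block_operator A0 A1) T"
    and "matrix_spectrum A0 \<subseteq> {z. Re z < 0}"
    and "Omega_plus A0 \<phi> \<subseteq> closure {z. Re z < 0}"
    and "char_fun_completely_monotonic A0 \<phi>"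
  shows "bdd_above ((\<lambda>t. lp_operator_norm p (T t)) ` {0..})"
proof -
  note p = \<open>1 \<le> p\<close>
  define A B where "A = endo_of_matrix A0" and "B = endo_of_matrix A1"
  define f where "f s = Re (\<phi> (of_real s))" for s :: real
  define R where "R s = endo_of_matrix (matrix_resolvent (of_real s) A0)" for s :: real
  have res: "of_real s \<in> matrix_resolvent_set A0" if "s > 0" for s :: real
    using assms(7) that by (auto simp: char_fun_completely_monotonic_def)
  have \<phi>_real: "\<phi> (of_real s) = of_real (f s)" if "s > 0" for s
    using assms(7) that by (auto simp: char_fun_completely_monotonic_def f_def elim!: Reals_cases)
  have cm: "completely_monotonic f"
    using assms(7) by (simp add: char_fun_completely_monotonic_def f_def[abs_def])
  have f_nonneg: "f s \<ge> 0" if "s > 0" for s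
    using cm that unfolding completely_monotonic_def by (metis funpow_0 mult_1 power_0)
  have f_less: "f s < 1" if s: "s > 0" for s
  proof (rule ccontr)
    assume "\<not> f s < 1"
    then have "of_real s \<in> Omega_plus A0 \<phi>"
      using res[OF s] by (simp add: Omega_plus_def \<phi>_real[OF s])
    moreover have "closure {z. Re z < 0} \<subseteq> {z. Re z \<le> 0}"
      by (intro closure_minimal) (auto simp: closed_halfspace_Re_le)
    ultimately show False
      using assms(6) s by auto
  qed
  have B: "B \<noteq> 0"
    using endo_of_matrix_eq_0 assms(2) by (auto simp: B_def)
  interpret positive_resolvent A R
  proof
    fix s :: real assume "s > 0"
    then have inv: "invertible (mat (of_real s) - A0)"
      using res by (simp add: matrix_resolvent_set_def)
    have inverse: "(mat (of_real s) - A0) ** matrix_inv (mat (of_real s) - A0) = mat 1"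
      "matrix_inv (mat (of_real s) - A0) ** (mat (of_real s) - A0) = mat 1"
      using someI_ex[OF inv[unfolded invertible_def]] by (simp_all add: matrix_inv_def)
    have eq: "of_real s - A = endo_of_matrix (mat (of_real s) - A0)"
      by (simp add: endo_of_matrix_diff endo_of_matrix_mat A_def)
    have one: "endo_of_matrix (mat 1 :: complex^'m^'m) = 1"
      using endo_of_matrix_mat[of 1, where 'm = 'm] by simp
    show "(of_real s - A) * R s = 1" "R s * (of_real s - A) = 1"
      unfolding eq R_def matrix_resolvent_def
      by (simp_all add: inverse one flip: endo_of_matrix_mult)
  qed
  have BRB: "B * R s * B = f s *\<^sub>R B" if "s > 0" for s
  proof -
    have "A1 ** matrix_resolvent (of_real s) A0 ** A1 = matrix_scale (of_real (f s)) A1"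
      using assms(3) res[OF that] \<phi>_real[OF that] by (simp add: characteristic_function_def)
    then show ?thesis
      unfolding B_def R_def by (metis endo_of_matrix_mult endo_of_matrix_scale)
  qed
  have "B * R s ^ Suc k * B \<in> ray B" if "s > 0" for s k
  proof -
    have "(- 1) ^ k * (deriv ^^ k) f s / fact k \<ge> 0"
      using cm that by (simp add: completely_monotonic_def)
    moreover have "B * R s ^ Suc k * B = ((- 1) ^ k * (deriv ^^ k) f s / fact k) *\<^sub>R B"
      by (rule sandwiched_power_R[OF cm _ that]) (rule BRB)
    ultimately show ?thesis
      unfolding ray_def by blast
  qed
  then have in_ray: "B * exp (u *\<^sub>R A) * B \<in> ray B" if "u \<ge> 0" for u
    using sandwiched_exp_in_ray[OF B that] by blast
  \<comment> \<open>As the scalar is nonnegative, it is a quotient of norms, which shows that it depends continuously on \<open>u\<close>.\<close>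
  define h where "h u = norm (B * exp (u *\<^sub>R A) * B) / norm B" for u
  have h_nonneg: "h u \<ge> 0" for u
    by (simp add: h_def)
  have sandwich: "B * exp (u *\<^sub>R A) * B = h u *\<^sub>R B" if "u \<ge> 0" for u
    using in_ray[OF that] B by (auto simp: h_def ray_def)
  have "continuous_on {0..} (\<lambda>u. exp (u *\<^sub>R A))"
    by (rule continuous_on_vector_derivative, rule exp_scaleR_has_vector_derivative_right)
  then have h_cont: "continuous_on {0..} h"
    unfolding h_def using B by (intro continuous_intros) auto
  obtain b M where b: "b > 0" and stable: "\<And>u. u \<ge> 0 \<Longrightarrow> norm (exp (u *\<^sub>R A)) \<le> M * exp (- (b * u))"
    using exp_endo_exponentially_stable[OF assms(5)] unfolding A_def by blast
  have M: "M \<ge> 0"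
    using order_trans[OF norm_ge_zero stable[of 0]] by simp
  have mass: "integral {0..t} h \<le> 1" if "t \<ge> 0" for t
  proof (rule integral_kernel_le_one[OF B sandwich h_nonneg h_cont _ _ that])
    fix u :: real assume u: "u \<ge> 0"
    have "M * exp (- (b * u)) \<le> M * 1"
      using b u M by (intro mult_left_mono) auto
    then show "norm (exp (u *\<^sub>R A)) \<le> M"
      using stable[OF u] by simp
  next
    fix s :: real assume "s > 0"
    then show "norm (B * R s * B) \<le> norm B"
      using BRB f_nonneg f_less[of s] by (simp add: mult_left_le_one_le)
  qed
  obtain C where C: "C \<ge> 0" "\<And>t N. t \<ge> 0 \<Longrightarrow> (\<Sum>n<N. renewal_term h b n t) \<le> C"
    using renewal_sum_bounded[OF h_cont h_nonneg mass b] by blast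
  define K where "K = M + M * (norm B * M) * (C / b)"
  have T: "lp_C0_semigroup p T"
    using assms(4) by (simp add: lp_semigroup_generated_by_def)
  have "lp_norm p (T t x) \<le> K * lp_norm p x" if t: "t \<ge> 0" and x: "x \<in> lp_space p" for t x
  proof -
    have T0: "T 0 x = x"
      using T x by (simp add: lp_C0_semigroup_def)
    have deriv: "((\<lambda>s. T s x k) has_vector_derivative block_operator A0 A1 (T s x) k) (at s within {0..})"
      if "s \<ge> 0" for s k
      by (rule semigroup_component_derivative[OF p assms(4) x that])
    interpret scalar_cascade A0 A1 h b M "\<lambda>k s. T s x k"
    proof
      show "((\<lambda>s. T s x 0) has_vector_derivative A0 *v T s x 0) (at s within {0..})" if "s \<ge> 0" for s
        using deriv[OF that, of 0] by (simp add: block_operator_def)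
      show "((\<lambda>s. T s x (Suc k)) has_vector_derivative A0 *v T s x (Suc k) + A1 *v T s x k) (at s within {0..})"
        if "s \<ge> 0" for s k
        using deriv[OF that, of "Suc k"] by (simp add: block_operator_def)
    qed (use sandwich h_cont h_nonneg stable b in \<open>simp_all add: A_def B_def\<close>)
    show ?thesis
      using norm_y_le[OF t] gain_nonneg[OF t] sum_gain_le[OF t C]
      by (intro lp_young(2)[OF p x, of "gain t"]) (simp_all add: T0 K_def B_def)
  qed
  note T_le = this
  have "lp_operator_norm p (T t) \<le> \<bar>K\<bar>" if t: "t \<ge> 0" for t
    unfolding lp_operator_norm_def
  proof (rule cSup_least)
    show "{lp_norm p (T t x) |x. x \<in> lp_space p \<and> lp_norm p x \<le> 1} \<noteq> {}"
      using lp_zero[OF p, where 'm = 'm] by (auto intro!: exI[of _ "\<lambda>k. 0"])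
    fix c assume "c \<in> {lp_norm p (T t x) |x. x \<in> lp_space p \<and> lp_norm p x \<le> 1}"
    then obtain x where x: "x \<in> lp_space p" "lp_norm p x \<le> 1" "c = lp_norm p (T t x)"
      by blast
    have "K * lp_norm p x \<le> \<bar>K\<bar> * 1"
      using x lp_norm_nonneg[OF p x(1)] by (intro mult_mono) auto
    then show "c \<le> \<bar>K\<bar>"
      using T_le[OF t x(1)] x(3) by simp
  qed
  then show ?thesis
    by (auto intro!: bdd_aboveI[of _ "\<bar>K\<bar>"])
qed

end
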